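(* Let $f:\mathbb{R}\to \mathbb{R}$ be a continuous function, let $\rho>0$ and let $\omega:[0,\rho[\,\to [0,+\infty[$ be a continuous (strictly) increasing function such that $\lim_{\xi\to \rho^-}\int_0^{\xi}\omega(x)\,dx=+\infty$. Consider $C^0([0,1])\times C^0([0,1])$ endowed with the norm $$\|(\alpha,\beta)\|=\int_0^1|\alpha(t)|\,dt+\int_0^1|\beta(t)|\,dt.$$ Then, the following assertions are equivalent: (a) the restriction of $f$ to $\left[-\frac{\sqrt{\rho}}{2},\frac{\sqrt{\rho}}{2}\right]$ is not constant; (b) for every convex set $S\subseteq C^0([0,1])\times C^0([0,1])$ dense in $C^0([0,1])\times C^0([0,1])$, there exists $(\alpha,\beta)\in S$ such that the problem $$\begin{cases}-\omega\left(\int_0^1|u'(t)|^2dt\right)u''=\beta(t)f(u)+\alpha(t) & \text{in } [0,1]\\ u(0)=u(1)=0\\ \int_0^1|u'(t)|^2dt<\rho\end{cases}$$ has at least two classical solutions.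
   Context: $C^0([0,1])$ is the space of continuous real-valued functions on $[0,1]$; density in (b) is with respect to the indicated norm. A classical solution is a function $u\in C^2([0,1])$ satisfying the three conditions of the problem, with the equation holding at every $t\in[0,1]$. *)

theory Defs
  imports "HOL-Analysis.Analysis"
begin

text \<open>
  Elements of \<open>C\<^sup>0([0,1])\<close> are represented by real functions that are continuous on \<open>[0,1]\<close>
  (with respect to the subspace topology) and normalised to \<open>0\<close> off \<open>[0,1]\<close>, so that equality
  of elements is equality on \<open>[0,1]\<close> and the vector space operations are pointwise.
\<close>

typedef C0_unit = "{g :: real \<Rightarrow> real. continuous_on {0..1} g \<and> (\<forall>t. t \<notin> {0..1} \<longrightarrow> g t = 0)}"
  morphisms C0_apply C0_abs
  by (rule exI[of _ "\<lambda>_. 0"]) simp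

setup_lifting type_definition_C0_unit

instantiation C0_unit :: real_vector
begin

lift_definition zero_C0_unit :: C0_unit is "\<lambda>_. 0"
  by simp

lift_definition plus_C0_unit :: "C0_unit \<Rightarrow> C0_unit \<Rightarrow> C0_unit" is "\<lambda>g h t. g t + h t"
  by (auto intro: continuous_on_add)

lift_definition minus_C0_unit :: "C0_unit \<Rightarrow> C0_unit \<Rightarrow> C0_unit" is "\<lambda>g h t. g t - h t"
  by (auto intro: continuous_on_diff)

lift_definition uminus_C0_unit :: "C0_unit \<Rightarrow> C0_unit" is "\<lambda>g t. - g t"
  by (auto intro: continuous_on_minus)

lift_definition scaleR_C0_unit :: "real \<Rightarrow> C0_unit \<Rightarrow> C0_unit" is "\<lambda>c g t. c * g t"
  by (auto intro: continuous_on_mult_left)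

instance
  by standard (transfer; simp add: fun_eq_iff algebra_simps)+

end

definition pair_norm :: "C0_unit \<times> C0_unit \<Rightarrow> real" where
  "pair_norm p = integral {0..1} (\<lambda>t. \<bar>C0_apply (fst p) t\<bar>)
               + integral {0..1} (\<lambda>t. \<bar>C0_apply (snd p) t\<bar>)"

definition dense_pair :: "(C0_unit \<times> C0_unit) set \<Rightarrow> bool" where
  "dense_pair S \<longleftrightarrow> (\<forall>p. \<forall>e>0. \<exists>q\<in>S. pair_norm (q - p) < e)"

text \<open>
  In the next two definitions derivatives are taken within \<open>[0,1]\<close>, hence are one-sided at the
  endpoints; the values of \<open>u\<close>, \<open>u'\<close> and \<open>u''\<close> off \<open>[0,1]\<close> play no role.
\<close>

definition C2_derivs :: "(real \<Rightarrow> real) \<Rightarrow> (real \<Rightarrow> real) \<Rightarrow> (real \<Rightarrow> real) \<Rightarrow> bool" where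
  "C2_derivs u u' u'' \<longleftrightarrow>
     (\<forall>t\<in>{0..1}. (u has_real_derivative u' t) (at t within {0..1})) \<and>
     (\<forall>t\<in>{0..1}. (u' has_real_derivative u'' t) (at t within {0..1})) \<and>
     continuous_on {0..1} u''"

definition classical_solution ::
    "(real \<Rightarrow> real) \<Rightarrow> real \<Rightarrow> (real \<Rightarrow> real) \<Rightarrow> C0_unit \<Rightarrow> C0_unit \<Rightarrow> (real \<Rightarrow> real) \<Rightarrow> bool" where
  "classical_solution f \<rho> \<omega> \<alpha> \<beta> u \<longleftrightarrow>
     (\<exists>u' u''. C2_derivs u u' u'' \<and>
        (\<forall>t\<in>{0..1}. - \<omega> (integral {0..1} (\<lambda>s. \<bar>u' s\<bar>\<^sup>2)) * u'' t
                      = C0_apply \<beta> t * f (u t) + C0_apply \<alpha> t) \<and>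
        u 0 = 0 \<and> u 1 = 0 \<and>
        integral {0..1} (\<lambda>s. \<bar>u' s\<bar>\<^sup>2) < \<rho>)"

text \<open>Two solutions count as different only if they differ as functions on \<open>[0,1]\<close>.\<close>

definition two_classical_solutions ::
    "(real \<Rightarrow> real) \<Rightarrow> real \<Rightarrow> (real \<Rightarrow> real) \<Rightarrow> C0_unit \<Rightarrow> C0_unit \<Rightarrow> bool" where
  "two_classical_solutions f \<rho> \<omega> \<alpha> \<beta> \<longleftrightarrow>
     (\<exists>u v. classical_solution f \<rho> \<omega> \<alpha> \<beta> u \<and> classical_solution f \<rho> \<omega> \<alpha> \<beta> v \<and>
            (\<exists>t\<in>{0..1}. u t \<noteq> v t))"

end

theory Submission
  imports Defs "HOL-Complex_Analysis.Great_Picard"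
begin

text \<open>
  Classical solutions are the critical points of
  \<open>\<Omega>(\<integral>\<bar>u'\<bar>\<^sup>2) / 2 - \<integral>(\<alpha> u + \<beta> F(u))\<close>, where \<open>\<Omega>' = \<omega>\<close> and \<open>F' = f\<close>, on the open ball of radius
  \<open>\<surd>\<rho>\<close> of \<open>H\<^sub>0\<^sup>1\<close>, at whose boundary \<open>\<Omega>\<close> is infinite. The functional is affine in \<open>(\<alpha>, \<beta>)\<close>.
  If \<open>f\<close> is not constant, the range of \<open>u \<mapsto> (u, F \<circ> u)\<close> on the ball is not convex. Normalising the
  functional at a missing point of its convex hull bounds the minima uniformly in \<open>(\<alpha>, \<beta>)\<close> but makes
  the supremum over a dense set of \<open>(\<alpha>, \<beta>)\<close> infinite at every \<open>u\<close>. Uniqueness of all minimisers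
  would force \<open>sup inf = inf sup\<close>, so for some \<open>(\<alpha>, \<beta>)\<close> there are two global minimisers.
  Conversely, a solution satisfies \<open>\<bar>u\<bar> \<le> \<surd>\<rho> / 2\<close>, so if \<open>f\<close> is constant there, the right-hand side
  does not depend on \<open>u\<close> and determines it.
\<close>

text \<open>The radius \<open>sqrt \<rho> / 2\<close> is the sharp supremum bound for functions of
  energy \<rho> that vanish at 0 and 1. Tents of any smaller height lie in the ball, so both
  directions of the equivalence see the same interval. The obstacle is that S is only convex and
  dense for an integral norm, so nothing compact or closed is available in (\<alpha>, \<beta>). The
  minimax argument therefore asks for compactness in u alone and replaces S by the hull of finitely
  many of its points. Density is exploited through one fact: a nonzero functional (\<alpha>,
  \<beta>) |-> \<integral>(\<alpha> p + \<beta> q) with continuous p, q is continuous for the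
  integral norm, hence unbounded on a dense set. Energies come from difference quotients instead of
  weak derivatives. Compactness then reduces to Arzela-Ascoli in the sup metric; the price is to
  identify the limits of the quotients with integrals, for the energy of a solution and for the weak
  form of - w'' = h, where test functions are merely continuous. As \<omega> may vanish at 0, the
  equation can degenerate, but only at u = 0, which is treated separately.\<close>

section \<open>A minimax principle\<close>

text \<open>Sublevel sets at attained values form a chain, so finitely many of them always share a
  point; compactness yields a point common to all, which is a minimiser.\<close>

lemma compact_sublevels_attain_inf:
  fixes g :: "'a::t2_space \<Rightarrow> real"
  assumes ne: "X \<noteq> {}" and comp: "\<And>c. compact {x\<in>X. g x \<le> c}"
  shows "\<exists>x\<in>X. \<forall>z\<in>X. g x \<le> g z"
proof -
  obtain x0 where x0: "x0 \<in> X" using ne by auto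
  have "{x\<in>X. g x \<le> g x0} \<inter> (\<Inter>z\<in>X. {x\<in>X. g x \<le> g z}) \<noteq> {}"
  proof (rule compact_imp_fip_image[OF comp])
    show "closed {x\<in>X. g x \<le> g z}" for z by (rule compact_imp_closed[OF comp])
    fix I' assume I': "finite I'" "I' \<subseteq> X"
    obtain z where z: "z \<in> insert x0 I'" "\<And>y. y \<in> insert x0 I' \<Longrightarrow> g z \<le> g y"
      using ex_is_arg_min_if_finite[of "insert x0 I'" g] I'
      by (auto simp: is_arg_min_linorder)
    have "z \<in> {x\<in>X. g x \<le> g x0} \<inter> (\<Inter>z\<in>I'. {x\<in>X. g x \<le> g z})"
      using z x0 I' by auto
    then show "{x\<in>X. g x \<le> g x0} \<inter> (\<Inter>z\<in>I'. {x\<in>X. g x \<le> g z}) \<noteq> {}" by blast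
  qed
  then show ?thesis by blast
qed

text \<open>The maximum exists because an infimum of affine functions is upper semicontinuous
  in the barycentric weights.\<close>

lemma inf_affine_attains_sup:
  fixes L :: "'a \<Rightarrow> 'v::real_vector \<Rightarrow> real"
  assumes T: "finite T" "T \<noteq> {}"
    and lin: "\<And>x. x \<in> X \<Longrightarrow> linear (L x)"
    and sel: "\<And>y. y \<in> convex hull T \<Longrightarrow> s y \<in> X"
    and min: "\<And>y z. y \<in> convex hull T \<Longrightarrow> z \<in> X \<Longrightarrow> I (s y) + L (s y) y \<le> I z + L z y"
    and bound: "\<And>y. y \<in> convex hull T \<Longrightarrow> I (s y) + L (s y) y \<le> M"
  shows "\<exists>y\<in>convex hull T. \<forall>y'\<in>convex hull T. I (s y') + L (s y') y' \<le> I (s y) + L (s y) y"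
proof -
  define m where "m y = I (s y) + L (s y) y" for y
  define P where "P w = (\<Sum>i\<in>T. w i *\<^sub>R i)" for w :: "'v \<Rightarrow> real"
  define W where "W = {w::'v \<Rightarrow> real. (\<forall>i\<in>T. 0 \<le> w i) \<and> sum w T = 1}"
  have hull: "convex hull T = P ` W"
    unfolding convex_hull_finite[OF T(1)] P_def W_def by auto
  have ne: "convex hull T \<noteq> {}" using T by simp
  have bdd: "bdd_above (m ` (convex hull T))"
    unfolding bdd_above_def using bound m_def by auto
  define \<sigma> where "\<sigma> = (SUP y\<in>convex hull T. m y)"
  have "\<exists>w\<in>W. \<sigma> - inverse (Suc k) < m (P w)" for k
  proof -
    have "\<sigma> - inverse (Suc k) < \<sigma>" by simp
    then obtain y where "y \<in> convex hull T" "\<sigma> - inverse (Suc k) < m y"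
      unfolding \<sigma>_def using less_cSUP_iff[OF ne bdd] by auto
    then show ?thesis using hull by auto
  qed
  then obtain w where wW: "\<And>k. w k \<in> W" and wm: "\<And>k. \<sigma> - inverse (Suc k) < m (P (w k))"
    by metis
  have "norm (w k i) \<le> 1" if "i \<in> T" for k i
  proof -
    have "w k i \<le> sum (w k) T"
      by (rule member_le_sum) (use wW that T in \<open>auto simp: W_def\<close>)
    then show ?thesis using wW[of k] that by (simp add: W_def)
  qed
  then obtain r where r: "strict_mono r" "\<And>i. i \<in> T \<Longrightarrow> \<exists>l. (\<lambda>k. w (r k) i) \<longlonglongrightarrow> l"
    using function_convergent_subsequence[of T w 1, OF countable_finite[OF T(1)]] by blast
  then obtain v where v: "\<And>i. i \<in> T \<Longrightarrow> (\<lambda>k. w (r k) i) \<longlonglongrightarrow> v i" by metis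
  have "(\<lambda>k. sum (w (r k)) T) \<longlonglongrightarrow> sum v T" by (intro tendsto_sum v)
  moreover have "sum (w (r k)) T = 1" for k using wW by (auto simp: W_def)
  ultimately have "sum v T = 1" by (simp add: LIMSEQ_const_iff)
  moreover have "0 \<le> v i" if "i \<in> T" for i
    using LIMSEQ_le_const[OF v[OF that], of 0] wW that by (auto simp: W_def)
  ultimately have vW: "v \<in> W" by (auto simp: W_def)
  define y where "y = P v"
  have y: "y \<in> convex hull T" using vW hull y_def by auto
  have expand: "L x (P w) = (\<Sum>i\<in>T. w i * L x i)" if "x \<in> X" for x w
    unfolding P_def by (simp add: linear_sum[OF lin[OF that]] linear_scale[OF lin[OF that]])
  have lim: "(\<lambda>k. I (s y) + L (s y) (P (w (r k)))) \<longlonglongrightarrow> m y"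
    unfolding m_def y_def expand[OF sel[OF y], unfolded y_def] by (intro tendsto_intros v)
  have lim2: "(\<lambda>k. \<sigma> - inverse (Suc (r k))) \<longlonglongrightarrow> \<sigma> - 0"
    by (intro tendsto_diff tendsto_const)
      (use LIMSEQ_subseq_LIMSEQ[OF LIMSEQ_inverse_real_of_nat r(1)] in \<open>simp add: o_def\<close>)
  \<comment> \<open>The single competitor \<open>s y\<close> bounds the infimum at every
    approximating point by an expression affine in the weights, and this bound passes to the
    limit.\<close>
  have "\<sigma> - inverse (Suc (r k)) \<le> I (s y) + L (s y) (P (w (r k)))" for k
  proof -
    have "P (w (r k)) \<in> convex hull T" using hull wW by auto
    then have "m (P (w (r k))) \<le> I (s y) + L (s y) (P (w (r k)))"
      unfolding m_def using min sel[OF y] by blast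
    then show ?thesis using wm[of "r k"] by linarith
  qed
  then have "\<sigma> \<le> m y" using LIMSEQ_le[OF lim2 lim] by simp
  moreover have "m y' \<le> \<sigma>" if "y' \<in> convex hull T" for y'
    unfolding \<sigma>_def using cSUP_upper[OF that bdd] .
  ultimately have "\<forall>y'\<in>convex hull T. m y' \<le> m y" by (blast intro: order_trans)
  then show ?thesis using y unfolding m_def by blast
qed

text \<open>If every minimiser were unique, then at a maximum point \<open>y\<close> of the concave function
  \<open>y \<mapsto> min\<^sub>x (I x + L x y)\<close> over the hull of finitely many points of \<open>S\<close>, the minimiser at \<open>y\<close>
  (the limit of the minimisers at nearby points) would keep all of these points below \<open>M\<close>;
  by compactness this contradicts \<open>high\<close>.\<close>

theorem two_global_minimizers:
  fixes X :: "'a::t2_space set" and S :: "'v::real_vector set"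
    and I :: "'a \<Rightarrow> real" and L :: "'a \<Rightarrow> 'v \<Rightarrow> real"
  assumes lin: "\<And>x. x \<in> X \<Longrightarrow> linear (L x)"
    and S: "convex S" "S \<noteq> {}"
    and comp: "\<And>y c. y \<in> S \<Longrightarrow> compact {x\<in>X. I x + L x y \<le> c}"
    and low: "\<And>y. y \<in> S \<Longrightarrow> \<exists>x\<in>X. I x + L x y \<le> M"
    and high: "\<And>x. x \<in> X \<Longrightarrow> \<exists>y\<in>S. M < I x + L x y"
  shows "\<exists>y\<in>S. \<exists>u\<in>X. \<exists>v\<in>X. u \<noteq> v \<and> (\<forall>z\<in>X. I u + L u y \<le> I z + L z y)
           \<and> (\<forall>z\<in>X. I v + L v y \<le> I z + L z y)"
proof (rule ccontr)
  assume contra: "\<not> ?thesis"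
  have ne: "X \<noteq> {}" using S low by blast
  obtain s where sX: "\<And>y. y \<in> S \<Longrightarrow> s y \<in> X"
    and smin: "\<And>y z. y \<in> S \<Longrightarrow> z \<in> X \<Longrightarrow> I (s y) + L (s y) y \<le> I z + L z y"
  proof -
    have "\<exists>x\<in>X. \<forall>z\<in>X. I x + L x y \<le> I z + L z y" if "y \<in> S" for y
      by (rule compact_sublevels_attain_inf[OF ne comp[OF that]])
    then obtain s where "\<And>y. y \<in> S \<Longrightarrow> s y \<in> X \<and> (\<forall>z\<in>X. I (s y) + L (s y) y \<le> I z + L z y)"
      by metis
    then show ?thesis using that by blast
  qed
  define m where "m y = I (s y) + L (s y) y" for y
  have uniq: "u = s y" if "y \<in> S" "u \<in> X" "I u + L u y \<le> m y" for u y
  proof (rule ccontr)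
    assume "u \<noteq> s y"
    moreover have "\<forall>z\<in>X. I u + L u y \<le> I z + L z y"
      using that(3) smin[OF that(1)] unfolding m_def by (blast intro: order_trans)
    ultimately show False using contra that(1,2) sX[OF that(1)] smin[OF that(1)] by blast
  qed
  have mM: "m y \<le> M" if "y \<in> S" for y
    using low[OF that] smin[OF that] unfolding m_def by (blast intro: order_trans)
  obtain y0 where y0: "y0 \<in> S" using S by auto
  \<comment> \<open>Otherwise compactness would give one x staying below M for every y in S, against
    \<open>high\<close>. The set at \<open>y0\<close> serves as the compact one.\<close>
  have "\<exists>T. finite T \<and> T \<subseteq> S \<and>
      {x\<in>X. I x + L x y0 \<le> M} \<inter> (\<Inter>y\<in>T. {x\<in>X. I x + L x y \<le> M}) = {}"
  proof (rule ccontr)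
    assume none: "\<not> ?thesis"
    have "{x\<in>X. I x + L x y0 \<le> M} \<inter> (\<Inter>y\<in>S. {x\<in>X. I x + L x y \<le> M}) \<noteq> {}"
    proof (rule compact_imp_fip_image[OF comp[OF y0]])
      show "closed {x\<in>X. I x + L x y \<le> M}" if "y \<in> S" for y
        by (rule compact_imp_closed[OF comp[OF that]])
      show "{x\<in>X. I x + L x y0 \<le> M} \<inter> (\<Inter>y\<in>T. {x\<in>X. I x + L x y \<le> M}) \<noteq> {}"
        if "finite T" "T \<subseteq> S" for T
        using none that by auto
    qed
    then obtain x where "x \<in> X" "\<And>y. y \<in> S \<Longrightarrow> I x + L x y \<le> M" by auto
    then show False using high by fastforce
  qed
  then obtain T0 where T0: "finite T0" "T0 \<subseteq> S"
    "{x\<in>X. I x + L x y0 \<le> M} \<inter> (\<Inter>y\<in>T0. {x\<in>X. I x + L x y \<le> M}) = {}" by blast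
  define T where "T = insert y0 T0"
  have T: "finite T" "T \<noteq> {}" "T \<subseteq> S" using T0 y0 T_def by auto
  have empty: "\<not> (\<forall>y\<in>T. I x + L x y \<le> M)" if "x \<in> X" for x
    using T0(3) that unfolding T_def by blast
  have hS: "convex hull T \<subseteq> S" using T(3) S(1) by (simp add: hull_minimal)
  obtain y where yh: "y \<in> convex hull T" and ymax: "\<And>y'. y' \<in> convex hull T \<Longrightarrow> m y' \<le> m y"
  proof -
    have "\<exists>y\<in>convex hull T. \<forall>y'\<in>convex hull T. I (s y') + L (s y') y' \<le> I (s y) + L (s y) y"
    proof (rule inf_affine_attains_sup[OF T(1,2) lin])
      fix y assume "y \<in> convex hull T"
      then have "y \<in> S" using hS by auto
      then show "s y \<in> X" "I (s y) + L (s y) y \<le> M"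
        "\<And>z. z \<in> X \<Longrightarrow> I (s y) + L (s y) y \<le> I z + L z y"
        using sX mM smin unfolding m_def by auto
    qed
    then show ?thesis using that unfolding m_def by blast
  qed
  have yS: "y \<in> S" using yh hS by auto
  have "I (s y) + L (s y) i \<le> m y" if "i \<in> T" for i
  proof -
    have ih: "i \<in> convex hull T" using that hull_inc by fastforce
    have iS: "i \<in> S" using that T by auto
    define A where "A \<epsilon> = {x\<in>X. I x + L x y \<le> m y + \<epsilon>}" for \<epsilon>
    \<comment> \<open>A point of this intersection plays the role of the limit of the minimisers at
      points of the segment from y to i as these approach y.\<close>
    have "{x\<in>X. I x + L x i \<le> m y} \<inter> (\<Inter>\<epsilon>\<in>{0<..}. A \<epsilon>) \<noteq> {}"
    proof (rule compact_imp_fip_image[OF comp[OF iS]])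
      show "closed (A \<epsilon>)" for \<epsilon> unfolding A_def by (rule compact_imp_closed[OF comp[OF yS]])
      fix E :: "real set" assume E: "finite E" "E \<subseteq> {0<..}"
      define \<epsilon> where "\<epsilon> = Min (insert 1 E)"
      have \<epsilon>: "0 < \<epsilon>" "\<And>e. e \<in> E \<Longrightarrow> \<epsilon> \<le> e"
        unfolding \<epsilon>_def using E by (auto simp: Min_gr_iff)
      define d where "d = \<bar>m y - m i\<bar> + 1"
      \<comment> \<open>The solution of t * d = (1 - t) * \<epsilon>: it converts the possible gain
        at i, at most t * d, into an excess of at most \<epsilon> at y.\<close>
      define t where "t = \<epsilon> / (\<epsilon> + d)"
      have d: "d > 0" unfolding d_def by simp
      have t: "0 < t" "t < 1" unfolding t_def using \<epsilon> d by auto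
      define y' where "y' = (1 - t) *\<^sub>R y + t *\<^sub>R i"
      have y'h: "y' \<in> convex hull T"
        unfolding y'_def using convexD_alt[OF convex_convex_hull yh ih] t by simp
      have y'S: "y' \<in> S" using y'h hS by auto
      define x where "x = s y'"
      have x: "x \<in> X" unfolding x_def using sX y'S by auto
      have "L x y' = (1 - t) * L x y + t * L x i"
        unfolding y'_def using lin[OF x] by (simp add: linear_add linear_scale)
      then have my': "m y' = (1 - t) * (I x + L x y) + t * (I x + L x i)"
        unfolding m_def x_def[symmetric] by (simp add: algebra_simps)
      have a: "m y \<le> I x + L x y" using smin[OF yS x] m_def by auto
      have b: "m i \<le> I x + L x i" using smin[OF iS x] m_def by auto
      have le: "(1 - t) * (I x + L x y) + t * (I x + L x i) \<le> m y" using ymax[OF y'h] my' by simp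
      have "(1 - t) * m y \<le> (1 - t) * (I x + L x y)" using a t by (intro mult_left_mono) auto
      then have "t * (I x + L x i) \<le> t * m y" using le by (simp add: algebra_simps)
      then have c1: "I x + L x i \<le> m y" using t by simp
      have "t * m i \<le> t * (I x + L x i)" using b t by (intro mult_left_mono) auto
      then have "(1 - t) * (I x + L x y) \<le> m y - t * m i" using le by linarith
      then have "(1 - t) * (I x + L x y) \<le> (1 - t) * m y + t * (m y - m i)"
        by (simp add: algebra_simps)
      also have "\<dots> \<le> (1 - t) * m y + t * d" using t d_def by (intro add_left_mono mult_left_mono) auto
      also have "t * d = (1 - t) * \<epsilon>" unfolding t_def using \<epsilon> d by (simp add: field_simps)
      finally have "(1 - t) * (I x + L x y) \<le> (1 - t) * (m y + \<epsilon>)" by (simp add: algebra_simps)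
      then have c2: "I x + L x y \<le> m y + \<epsilon>" using t by simp
      have "x \<in> {x\<in>X. I x + L x i \<le> m y} \<inter> (\<Inter>\<epsilon>\<in>E. A \<epsilon>)"
        unfolding A_def using x c1 c2 \<epsilon>(2) by fastforce
      then show "{x\<in>X. I x + L x i \<le> m y} \<inter> (\<Inter>\<epsilon>\<in>E. A \<epsilon>) \<noteq> {}" by blast
    qed
    then obtain u where u: "u \<in> X" "I u + L u i \<le> m y" "\<And>\<epsilon>. \<epsilon> > 0 \<Longrightarrow> I u + L u y \<le> m y + \<epsilon>"
      unfolding A_def by auto
    have "I u + L u y \<le> m y" by (rule field_le_epsilon) (rule u(3))
    then show ?thesis using u(2) uniq[OF yS u(1)] by simp
  qed
  then show False using empty[OF sX[OF yS]] mM[OF yS] by fastforce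
qed

section \<open>Dirichlet energy by dyadic differences\<close>

text \<open>The space \<open>H\<^sub>0\<^sup>1(0,1)\<close> is realised by continuous functions: \<open>u\<close> belongs to it iff the energies
  of its piecewise linear interpolants at the dyadic points, which increase under refinement, are
  bounded, and their limit is \<open>\<integral>\<bar>u'\<bar>\<^sup>2\<close>. As a supremum of pointwise continuous functionals the energy
  is lower semicontinuous.\<close>

definition dform :: "nat \<Rightarrow> (real \<Rightarrow> real) \<Rightarrow> (real \<Rightarrow> real) \<Rightarrow> real" where
  "dform n u v = 2 ^ n * (\<Sum>i<2 ^ n. (u (real (Suc i) / 2 ^ n) - u (real i / 2 ^ n))
                                   * (v (real (Suc i) / 2 ^ n) - v (real i / 2 ^ n)))"

definition finite_energy :: "(real \<Rightarrow> real) \<Rightarrow> bool" where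
  "finite_energy u \<longleftrightarrow> continuous_on UNIV u \<and> (\<forall>t. t \<notin> {0<..<1} \<longrightarrow> u t = 0) \<and>
     bdd_above (range (\<lambda>n. dform n u u))"

definition dirichlet :: "(real \<Rightarrow> real) \<Rightarrow> (real \<Rightarrow> real) \<Rightarrow> real" where
  "dirichlet u v = lim (\<lambda>n. dform n u v)"

lemma dform_commute: "dform n u v = dform n v u"
  by (simp add: dform_def mult.commute)

lemma dform_lincomb_left:
  "dform n (\<lambda>t. a * u t + b * v t) z = a * dform n u z + b * dform n v z"
  unfolding dform_def
  by (simp add: sum_distrib_left sum.distrib[symmetric] algebra_simps)

lemma dform_lincomb:
  "dform n (\<lambda>t. a * u t + b * v t) (\<lambda>t. a * u t + b * v t)
     = a\<^sup>2 * dform n u u + 2 * a * b * dform n u v + b\<^sup>2 * dform n v v"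
proof -
  have "dform n (\<lambda>t. a * u t + b * v t) (\<lambda>t. a * u t + b * v t)
      = a * (a * dform n u u + b * dform n v u) + b * (a * dform n u v + b * dform n v v)"
    by (simp only: dform_lincomb_left dform_commute[of n _ "\<lambda>t. a * u t + b * v t"])
  then show ?thesis by (simp add: dform_commute[of n v u] algebra_simps power2_eq_square)
qed

lemma dform_nonneg: "0 \<le> dform n u u"
  unfolding dform_def by (simp add: sum_nonneg)

text \<open>Parallelogram law: the two sides differ by the form of a u - b v.\<close>

lemma dform_lincomb_le:
  "dform n (\<lambda>t. a * u t + b * v t) (\<lambda>t. a * u t + b * v t)
     \<le> 2 * a\<^sup>2 * dform n u u + 2 * b\<^sup>2 * dform n v v"
  using dform_nonneg[of n "\<lambda>t. a * u t + (- b) * v t"]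
  unfolding dform_lincomb by (simp add: algebra_simps)

lemma sum_lessThan_double: "(\<Sum>i<2 * N. g i) = (\<Sum>i<N. g (2 * i) + g (Suc (2 * i)))"
  for g :: "nat \<Rightarrow> real"
  by (induction N) auto

text \<open>Halving a cell splits its increment into x + y, and the loss in (x + y)^2 \<le> 2 (x^2 +
  y^2) is exactly the factor gained by passing from \<open>2 ^ n\<close> to
  \<open>2 ^ Suc n\<close>.\<close>

lemma dform_Suc_ge: "dform n u u \<le> dform (Suc n) u u"
proof -
  define a where "a i = u (real i / 2 ^ Suc n)" for i
  have a: "u (real i / 2 ^ n) = a (2 * i)" "u (real (Suc i) / 2 ^ n) = a (Suc (Suc (2 * i)))" for i
  proof -
    have "real i / 2 ^ n = real (2 * i) / 2 ^ Suc n"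
      "real (Suc i) / 2 ^ n = real (Suc (Suc (2 * i))) / 2 ^ Suc n"
      by (simp_all add: field_simps)
    then show "u (real i / 2 ^ n) = a (2 * i)" "u (real (Suc i) / 2 ^ n) = a (Suc (Suc (2 * i)))"
      unfolding a_def by (simp_all only:)
  qed
  have "dform n u u = 2 ^ n * (\<Sum>i<2 ^ n. (a (Suc (Suc (2 * i))) - a (2 * i))\<^sup>2)"
    unfolding dform_def a by (simp add: power2_eq_square)
  also have "\<dots> \<le> 2 ^ n * (\<Sum>i<2 ^ n. 2 * ((a (Suc (2 * i)) - a (2 * i))\<^sup>2
      + (a (Suc (Suc (2 * i))) - a (Suc (2 * i)))\<^sup>2))"
  proof (intro mult_left_mono sum_mono)
    fix i
    show "(a (Suc (Suc (2 * i))) - a (2 * i))\<^sup>2 \<le> 2 * ((a (Suc (2 * i)) - a (2 * i))\<^sup>2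
      + (a (Suc (Suc (2 * i))) - a (Suc (2 * i)))\<^sup>2)"
      using zero_le_power2[of "a (Suc (Suc (2 * i))) - 2 * a (Suc (2 * i)) + a (2 * i)"]
      by (simp add: power2_eq_square algebra_simps)
  qed simp
  also have "\<dots> = 2 ^ Suc n * (\<Sum>i<2 * 2 ^ n. (a (Suc i) - a i)\<^sup>2)"
    unfolding sum_lessThan_double sum_distrib_left by (simp add: algebra_simps)
  also have "\<dots> = dform (Suc n) u u"
    unfolding dform_def a_def by (simp add: power2_eq_square)
  finally show ?thesis .
qed

lemma finite_energyD:
  assumes "finite_energy u"
  shows "continuous_on A u" "t \<notin> {0<..<1} \<Longrightarrow> u t = 0" "bdd_above (range (\<lambda>n. dform n u u))"
  using assms continuous_on_subset[of UNIV u A] by (auto simp: finite_energy_def)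

lemma finite_energy_lincomb:
  assumes u: "finite_energy u" and v: "finite_energy v"
  shows "finite_energy (\<lambda>t. a * u t + b * v t)"
  unfolding finite_energy_def
proof (intro conjI allI impI)
  show "continuous_on UNIV (\<lambda>t. a * u t + b * v t)"
    by (intro continuous_intros finite_energyD u v)
  show "a * u t + b * v t = 0" if "t \<notin> {0<..<1}" for t
    using finite_energyD(2)[OF u that] finite_energyD(2)[OF v that] by simp
  obtain K where K: "\<And>n. dform n u u \<le> K"
    using finite_energyD(3)[OF u] by (auto simp: bdd_above_def)
  obtain K' where K': "\<And>n. dform n v v \<le> K'"
    using finite_energyD(3)[OF v] by (auto simp: bdd_above_def)
  have "dform n (\<lambda>t. a * u t + b * v t) (\<lambda>t. a * u t + b * v t) \<le> 2 * a\<^sup>2 * K + 2 * b\<^sup>2 * K'" for n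
    by (rule order_trans[OF dform_lincomb_le]) (intro add_mono mult_left_mono K K'; simp)
  then show "bdd_above (range (\<lambda>n. dform n (\<lambda>t. a * u t + b * v t) (\<lambda>t. a * u t + b * v t)))"
    by (auto simp: bdd_above_def)
qed

lemma dform_convergent:
  assumes "finite_energy u"
  shows "convergent (\<lambda>n. dform n u u)"
proof (rule Bseq_monoseq_convergent)
  obtain K where K: "\<And>n. dform n u u \<le> K"
    using finite_energyD(3)[OF assms] by (auto simp: bdd_above_def)
  then show "Bseq (\<lambda>n. dform n u u)"
    by (intro BseqI'[of _ K]) (simp add: dform_nonneg)
  show "monoseq (\<lambda>n. dform n u u)"
    unfolding monoseq_Suc using dform_Suc_ge by blast
qed

text \<open>The mixed form is not monotone in n; polarisation expresses it by energies, which
  converge.\<close>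

lemma dirichlet_tendsto:
  assumes u: "finite_energy u" and v: "finite_energy v"
  shows "(\<lambda>n. dform n u v) \<longlonglongrightarrow> dirichlet u v"
proof -
  have "dform n u v = (dform n (\<lambda>t. 1 * u t + 1 * v t) (\<lambda>t. 1 * u t + 1 * v t)
      - dform n u u - dform n v v) * (1 / 2)" for n
    unfolding dform_lincomb by simp
  moreover have "convergent (\<lambda>n. (dform n (\<lambda>t. 1 * u t + 1 * v t) (\<lambda>t. 1 * u t + 1 * v t)
      - dform n u u - dform n v v) * (1 / 2))"
    by (intro convergent_mult convergent_diff dform_convergent finite_energy_lincomb u v
        convergent_const)
  ultimately have "convergent (\<lambda>n. dform n u v)" by presburger
  then show ?thesis unfolding dirichlet_def by (simp add: convergent_LIMSEQ_iff)
qed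

lemma dform_le_dirichlet:
  assumes "finite_energy u"
  shows "dform n u u \<le> dirichlet u u"
  by (rule incseq_le[OF _ dirichlet_tendsto[OF assms assms]]) (simp add: dform_Suc_ge incseq_SucI)

lemma dirichlet_nonneg: "finite_energy u \<Longrightarrow> 0 \<le> dirichlet u u"
  using dform_le_dirichlet[of u 0] dform_nonneg[of 0 u] by linarith

lemma dirichlet_lincomb_left:
  assumes "finite_energy u" "finite_energy v" "finite_energy z"
  shows "dirichlet (\<lambda>t. a * u t + b * v t) z = a * dirichlet u z + b * dirichlet v z"
proof (rule LIMSEQ_unique)
  show "(\<lambda>n. dform n (\<lambda>t. a * u t + b * v t) z) \<longlonglongrightarrow> dirichlet (\<lambda>t. a * u t + b * v t) z"
    by (intro dirichlet_tendsto finite_energy_lincomb assms)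
  show "(\<lambda>n. dform n (\<lambda>t. a * u t + b * v t) z) \<longlonglongrightarrow> a * dirichlet u z + b * dirichlet v z"
    unfolding dform_lincomb_left by (intro tendsto_intros dirichlet_tendsto assms)
qed

lemma dirichlet_lincomb:
  assumes "finite_energy u" "finite_energy v"
  shows "dirichlet (\<lambda>t. a * u t + b * v t) (\<lambda>t. a * u t + b * v t)
     = a\<^sup>2 * dirichlet u u + 2 * a * b * dirichlet u v + b\<^sup>2 * dirichlet v v"
proof (rule LIMSEQ_unique)
  show "(\<lambda>n. dform n (\<lambda>t. a * u t + b * v t) (\<lambda>t. a * u t + b * v t))
      \<longlonglongrightarrow> dirichlet (\<lambda>t. a * u t + b * v t) (\<lambda>t. a * u t + b * v t)"
    by (intro dirichlet_tendsto finite_energy_lincomb assms)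
  show "(\<lambda>n. dform n (\<lambda>t. a * u t + b * v t) (\<lambda>t. a * u t + b * v t))
      \<longlonglongrightarrow> a\<^sup>2 * dirichlet u u + 2 * a * b * dirichlet u v + b\<^sup>2 * dirichlet v v"
    unfolding dform_lincomb by (intro tendsto_intros dirichlet_tendsto assms)
qed

lemma dyadic_increment_le:
  assumes "i \<le> j" "j \<le> 2 ^ n"
  shows "(u (real j / 2 ^ n) - u (real i / 2 ^ n))\<^sup>2 \<le> (real j / 2 ^ n - real i / 2 ^ n) * dform n u u"
proof -
  define a where "a i = u (real i / 2 ^ n)" for i
  have "(a j - a i)\<^sup>2 = (\<Sum>k\<in>{i..<j}. a (Suc k) - a k)\<^sup>2"
    using assms by (simp add: sum_Suc_diff')
  \<comment> \<open>Cauchy-Schwarz on the telescoping sum; the number of cells, divided by the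
    \<open>2 ^ n\<close> in the form, becomes the length of the interval.\<close>
  also have "\<dots> \<le> (\<Sum>k\<in>{i..<j}. (a (Suc k) - a k)\<^sup>2) * card {i..<j}"
    by (rule sum_squared_le_sum_of_squares)
  also have "\<dots> \<le> (\<Sum>k<2 ^ n. (a (Suc k) - a k)\<^sup>2) * card {i..<j}"
    using assms by (intro mult_right_mono sum_mono2) auto
  also have "\<dots> = (real j / 2 ^ n - real i / 2 ^ n) * dform n u u"
    unfolding dform_def a_def using assms
    by (simp add: power2_eq_square of_nat_diff field_simps)
  finally show ?thesis unfolding a_def .
qed

lemma floor_dyadic_tendsto:
  assumes "0 \<le> t"
  shows "(\<lambda>n. real (nat \<lfloor>2 ^ n * t\<rfloor>) / 2 ^ n) \<longlonglongrightarrow> t"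
proof -
  have lim: "(\<lambda>n. (1 / 2 :: real) ^ n) \<longlonglongrightarrow> 0" by (rule LIMSEQ_realpow_zero) auto
  have e: "real (nat \<lfloor>2 ^ n * t\<rfloor>) = of_int \<lfloor>2 ^ n * t\<rfloor>" for n using assms by simp
  show ?thesis
  proof (rule tendsto_sandwich[OF _ _ _ tendsto_const])
    show "(\<lambda>n. t - (1 / 2) ^ n) \<longlonglongrightarrow> t" using tendsto_diff[OF tendsto_const lim] by simp
    have "t - (1 / 2) ^ n \<le> real (nat \<lfloor>2 ^ n * t\<rfloor>) / 2 ^ n" for n
    proof -
      have "2 ^ n * t - 1 \<le> of_int \<lfloor>2 ^ n * t\<rfloor>" by linarith
      then have "(2 ^ n * t - 1) / 2 ^ n \<le> of_int \<lfloor>2 ^ n * t\<rfloor> / 2 ^ n" by (intro divide_right_mono) auto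
      then show ?thesis unfolding e by (simp add: diff_divide_distrib power_one_over)
    qed
    then show "\<forall>\<^sub>F n in sequentially. t - (1 / 2) ^ n \<le> real (nat \<lfloor>2 ^ n * t\<rfloor>) / 2 ^ n" by simp
    have "real (nat \<lfloor>2 ^ n * t\<rfloor>) / 2 ^ n \<le> t" for n
    proof -
      have "of_int \<lfloor>2 ^ n * t\<rfloor> / 2 ^ n \<le> (2 ^ n * t) / 2 ^ n" by (intro divide_right_mono) auto
      then show ?thesis unfolding e by simp
    qed
    then show "\<forall>\<^sub>F n in sequentially. real (nat \<lfloor>2 ^ n * t\<rfloor>) / 2 ^ n \<le> t" by simp
  qed
qed

text \<open>Rounding both ends down to dyadic points preserves their order, so the discrete estimate
  passes to the limit by continuity of u.\<close>

lemma increment_le_dirichlet: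
  assumes u: "finite_energy u" and st: "0 \<le> s" "s \<le> t" "t \<le> 1"
  shows "(u t - u s)\<^sup>2 \<le> (t - s) * dirichlet u u"
proof -
  define p where "p n = real (nat \<lfloor>2 ^ n * s\<rfloor>) / 2 ^ n" for n :: nat
  define q where "q n = real (nat \<lfloor>2 ^ n * t\<rfloor>) / 2 ^ n" for n :: nat
  have p: "p \<longlonglongrightarrow> s" and q: "q \<longlonglongrightarrow> t"
    unfolding p_def q_def using floor_dyadic_tendsto st by auto
  have uc: "isCont u x" for x
    using finite_energyD(1)[OF u, of UNIV] by (simp add: continuous_on_eq_continuous_at)
  have "(u (q n) - u (p n))\<^sup>2 \<le> (q n - p n) * dform n u u" for n
    unfolding p_def q_def
  proof (rule dyadic_increment_le)
    have "2 ^ n * s \<le> 2 ^ n * t" using st by (simp add: mult_left_mono)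
    then show "nat \<lfloor>2 ^ n * s\<rfloor> \<le> nat \<lfloor>2 ^ n * t\<rfloor>" by (intro nat_mono floor_mono)
    have "2 ^ n * t \<le> 2 ^ n" using st mult_left_mono[of t 1 "2 ^ n"] by simp
    then have "\<lfloor>2 ^ n * t\<rfloor> \<le> 2 ^ n" by (metis floor_mono floor_of_int of_int_numeral of_int_power)
    then show "nat \<lfloor>2 ^ n * t\<rfloor> \<le> 2 ^ n" by (simp add: nat_le_iff)
  qed
  then show ?thesis
    by (intro LIMSEQ_le[of "\<lambda>n. (u (q n) - u (p n))\<^sup>2" _ "\<lambda>n. (q n - p n) * dform n u u"]
        tendsto_intros p q dirichlet_tendsto u isCont_tendsto_compose[OF uc]) auto
qed

lemma abs_increment_le_dirichlet:
  assumes u: "finite_energy u" and st: "s \<in> {0..1}" "t \<in> {0..1}"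
  shows "\<bar>u t - u s\<bar> \<le> sqrt (\<bar>t - s\<bar> * dirichlet u u)"
proof -
  have "(u t - u s)\<^sup>2 \<le> \<bar>t - s\<bar> * dirichlet u u"
    using increment_le_dirichlet[OF u, of s t] increment_le_dirichlet[OF u, of t s] st
    by (cases "s \<le> t") (auto simp: power2_commute)
  then show ?thesis by (intro real_le_rsqrt) simp
qed

text \<open>Cruder than \<open>abs_le_half_sqrt_energy\<close>, but enough for definiteness of the
  energy and for uniform bounds on the ball.\<close>

lemma abs_le_dirichlet:
  assumes u: "finite_energy u"
  shows "\<bar>u t\<bar> \<le> sqrt (dirichlet u u)"
proof (cases "t \<in> {0<..<1}")
  case True
  have "t * dirichlet u u \<le> 1 * dirichlet u u"
    using True dirichlet_nonneg[OF u] by (intro mult_right_mono) auto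
  then show ?thesis
    using abs_increment_le_dirichlet[OF u, of 0 t] True finite_energyD(2)[OF u, of 0]
    by (simp add: real_sqrt_le_iff order_trans)
next
  case False
  then show ?thesis using finite_energyD(2)[OF u] dirichlet_nonneg[OF u] by auto
qed

lemma dirichlet_eq_0:
  assumes "finite_energy u" "dirichlet u u = 0"
  shows "u t = 0"
  using abs_le_dirichlet[OF assms(1), of t] assms(2) by simp

text \<open>Meant for tents, whose kink puts them outside the C^1 formula for the energy.\<close>

lemma lipschitz_finite_energy:
  assumes cont: "continuous_on UNIV u" and zero: "\<And>t. t \<notin> {0<..<1} \<Longrightarrow> u t = 0"
    and lip: "\<And>s t. 0 \<le> s \<Longrightarrow> s \<le> t \<Longrightarrow> t \<le> 1 \<Longrightarrow> \<bar>u t - u s\<bar> \<le> C * (t - s)"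
  shows "finite_energy u" "dirichlet u u \<le> C\<^sup>2"
proof -
  have le: "dform n u u \<le> C\<^sup>2" for n
  proof -
    have "dform n u u \<le> 2 ^ n * (\<Sum>i::nat<2 ^ n. (C / 2 ^ n)\<^sup>2)"
      unfolding dform_def
    proof (intro mult_left_mono sum_mono)
      fix i :: nat assume "i \<in> {..<2 ^ n}"
      then have "Suc i \<le> 2 ^ n" by simp
      then have "real (Suc i) \<le> 2 ^ n" by (metis of_nat_le_iff of_nat_numeral of_nat_power)
      then have "\<bar>u (real (Suc i) / 2 ^ n) - u (real i / 2 ^ n)\<bar> \<le> C * (real (Suc i) / 2 ^ n - real i / 2 ^ n)"
        by (intro lip) (auto intro: divide_right_mono)
      also have "\<dots> = C / 2 ^ n" by (simp add: field_simps)
      finally have "\<bar>u (real (Suc i) / 2 ^ n) - u (real i / 2 ^ n)\<bar>\<^sup>2 \<le> (C / 2 ^ n)\<^sup>2"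
        by (intro power_mono) auto
      then show "(u (real (Suc i) / 2 ^ n) - u (real i / 2 ^ n)) * (u (real (Suc i) / 2 ^ n) - u (real i / 2 ^ n)) \<le> (C / 2 ^ n)\<^sup>2"
        by (simp add: power2_eq_square)
    qed simp
    also have "\<dots> = C\<^sup>2" by (simp add: power2_eq_square)
    finally show ?thesis .
  qed
  then show fe: "finite_energy u"
    unfolding finite_energy_def using cont zero by (auto simp: bdd_above_def)
  show "dirichlet u u \<le> C\<^sup>2"
    by (rule LIMSEQ_le_const2[OF dirichlet_tendsto[OF fe fe]]) (use le in auto)
qed

section \<open>Convergence of the dyadic forms\<close>

lemma integral_cells:
  fixes g :: "real \<Rightarrow> real"
  assumes g: "g integrable_on {0..1}" and N: "N > 0" and k: "k \<le> N"
  shows "(\<Sum>i<k. integral {real i / real N..real (Suc i) / real N} g) = integral {0..real k / real N} g"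
  using k
proof (induction k)
  case 0
  then show ?case by simp
next
  case (Suc k)
  have "real (Suc k) / real N \<le> 1" using Suc.prems N by simp
  then have "g integrable_on {0..real (Suc k) / real N}"
    by (intro integrable_on_subinterval[OF g]) auto
  then have "integral {0..real k / real N} g + integral {real k / real N..real (Suc k) / real N} g
      = integral {0..real (Suc k) / real N} g"
    by (intro Henstock_Kurzweil_Integration.integral_combine) (auto intro: divide_right_mono)
  then show ?case using Suc by simp
qed

text \<open>The two factors have separate sample points: after summation by parts z is evaluated at
  a node, w'' at a point produced by the mean value theorem, possibly in the neighbouring
  cell.\<close>

lemma riemann_product_tendsto:
  fixes z h :: "real \<Rightarrow> real"
  assumes z: "continuous_on {0..1} z" and h: "continuous_on {0..1} h"
    and p: "\<And>n i. i < 2 ^ n \<Longrightarrow> p n i \<in> {0..1} \<and> \<bar>p n i - real i / 2 ^ n\<bar> \<le> 1 / 2 ^ n"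
    and q: "\<And>n i. i < 2 ^ n \<Longrightarrow> q n i \<in> {0..1} \<and> \<bar>q n i - real i / 2 ^ n\<bar> \<le> 1 / 2 ^ n"
  shows "(\<lambda>n. (\<Sum>i<2 ^ n. z (p n i) * h (q n i)) / 2 ^ n) \<longlonglongrightarrow> integral {0..1} (\<lambda>t. z t * h t)"
proof (rule LIMSEQ_I)
  fix e :: real assume e: "e > 0"
  define g where "g t = z t * h t" for t
  have gc: "continuous_on {0..1} g" unfolding g_def by (intro continuous_intros z h)
  have gi: "g integrable_on {0..1}" by (rule integrable_continuous_interval[OF gc])
  obtain B1 where B1: "\<And>t. t \<in> {0..1} \<Longrightarrow> \<bar>z t\<bar> \<le> B1"
    using compact_imp_bounded[OF compact_continuous_image[OF z compact_Icc]]
    unfolding bounded_iff by (metis imageI real_norm_def)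
  obtain B2 where B2: "\<And>t. t \<in> {0..1} \<Longrightarrow> \<bar>h t\<bar> \<le> B2"
    using compact_imp_bounded[OF compact_continuous_image[OF h compact_Icc]]
    unfolding bounded_iff by (metis imageI real_norm_def)
  define B where "B = \<bar>B1\<bar> + \<bar>B2\<bar> + 1"
  have B: "B > 0" "\<And>t. t \<in> {0..1} \<Longrightarrow> \<bar>z t\<bar> \<le> B" "\<And>t. t \<in> {0..1} \<Longrightarrow> \<bar>h t\<bar> \<le> B"
    unfolding B_def using B1 B2 by (auto, fastforce+)
  \<comment> \<open>Varying the factors one at a time costs 2 * B * \<eta> = e / 2, which leaves
    room for the final strict inequality.\<close>
  define \<eta> where "\<eta> = e / (4 * B)"
  have \<eta>: "\<eta> > 0" unfolding \<eta>_def using e B by simp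
  obtain d1 where d1: "d1 > 0" "\<And>x y. x \<in> {0..1} \<Longrightarrow> y \<in> {0..1} \<Longrightarrow> \<bar>x - y\<bar> < d1 \<Longrightarrow> \<bar>z x - z y\<bar> < \<eta>"
    using compact_uniformly_continuous[OF z compact_Icc] \<eta>
    unfolding uniformly_continuous_on_def dist_real_def by metis
  obtain d2 where d2: "d2 > 0" "\<And>x y. x \<in> {0..1} \<Longrightarrow> y \<in> {0..1} \<Longrightarrow> \<bar>x - y\<bar> < d2 \<Longrightarrow> \<bar>h x - h y\<bar> < \<eta>"
    using compact_uniformly_continuous[OF h compact_Icc] \<eta>
    unfolding uniformly_continuous_on_def dist_real_def by metis
  have "(\<lambda>n. (1 / 2 :: real) ^ n) \<longlonglongrightarrow> 0" by (rule LIMSEQ_realpow_zero) auto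
  \<comment> \<open>Sample points and points of the cell are each within \<open>1 / 2 ^ n\<close> of
    the left node, so up to twice that from each other; hence the half.\<close>
  then obtain N where N: "\<And>n. n \<ge> N \<Longrightarrow> (1 / 2 :: real) ^ n < min d1 d2 / 2"
    using LIMSEQ_D[of _ 0 "min d1 d2 / 2"] d1 d2 by fastforce
  show "\<exists>no. \<forall>n\<ge>no. norm ((\<Sum>i<2 ^ n. z (p n i) * h (q n i)) / 2 ^ n - integral {0..1} (\<lambda>t. z t * h t)) < e"
  proof (intro exI allI impI)
    fix n assume "n \<ge> N"
    then have small: "2 / 2 ^ n < min d1 d2" using N[of n] by (simp add: power_one_over)
    have cell: "\<bar>z (p n i) * h (q n i) / 2 ^ n - integral {real i / 2 ^ n..real (Suc i) / 2 ^ n} g\<bar>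
        \<le> (e / 2) / 2 ^ n" if i: "i < 2 ^ n" for i
    proof -
      have w: "real (Suc i) / 2 ^ n - real i / 2 ^ n = 1 / 2 ^ n" by (simp add: field_simps)
      have le: "real i / 2 ^ n \<le> real (Suc i) / 2 ^ n" by (intro divide_right_mono) auto
      have "real (Suc i) \<le> 2 ^ n" using i by (metis Suc_leI of_nat_le_iff of_nat_numeral of_nat_power)
      then have sub: "{real i / 2 ^ n..real (Suc i) / 2 ^ n} \<subseteq> {0..1}" unfolding atLeastatMost_subset_iff by (simp add: divide_le_eq_1)
      have ptw: "\<bar>z (p n i) * h (q n i) - g x\<bar> \<le> e / 2"
        if x: "x \<in> {real i / 2 ^ n..real (Suc i) / 2 ^ n}" for x
      proof -
        have x01: "x \<in> {0..1}" using x sub by blast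
        have xi: "\<bar>x - real i / 2 ^ n\<bar> \<le> 1 / 2 ^ n" using x w by auto
        have "\<bar>p n i - x\<bar> \<le> 2 / 2 ^ n" "\<bar>q n i - x\<bar> \<le> 2 / 2 ^ n"
          using p[OF i] q[OF i] xi by linarith+
        then have zd: "\<bar>z (p n i) - z x\<bar> \<le> \<eta>" and hd: "\<bar>h (q n i) - h x\<bar> \<le> \<eta>"
          using d1(2)[of "p n i" x] d2(2)[of "q n i" x] p[OF i] q[OF i] x01 small by force+
        have "z (p n i) * h (q n i) - g x = z (p n i) * (h (q n i) - h x) + (z (p n i) - z x) * h x"
          unfolding g_def by (simp add: algebra_simps)
        also have "\<bar>\<dots>\<bar> \<le> B * \<eta> + \<eta> * B"
          using B(2)[of "p n i"] p[OF i] B(3)[OF x01] zd hd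
          by (intro order_trans[OF abs_triangle_ineq] add_mono) (auto simp: abs_mult intro!: mult_mono)
        also have "\<dots> = e / 2" unfolding \<eta>_def using B(1) by simp
        finally show ?thesis .
      qed
      have "((\<lambda>x. z (p n i) * h (q n i) - g x) has_integral
          (z (p n i) * h (q n i) * (1 / 2 ^ n) - integral {real i / 2 ^ n..real (Suc i) / 2 ^ n} g))
          {real i / 2 ^ n..real (Suc i) / 2 ^ n}"
        using has_integral_diff[OF has_integral_const_real integrable_integral[OF integrable_on_subinterval[OF gi sub]]]
          le w by (simp add: mult.commute)
      then have "norm (z (p n i) * h (q n i) * (1 / 2 ^ n) - integral {real i / 2 ^ n..real (Suc i) / 2 ^ n} g)
          \<le> e / 2 * measure lborel {real i / 2 ^ n..real (Suc i) / 2 ^ n}"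
        using e ptw by (intro has_integral_bound_real[where f = "\<lambda>x. z (p n i) * h (q n i) - g x"]) auto
      then show ?thesis using w le by simp
    qed
    have "integral {0..1} g = (\<Sum>i<2 ^ n. integral {real i / 2 ^ n..real (Suc i) / 2 ^ n} g)"
      using integral_cells[OF gi, of "2 ^ n" "2 ^ n"] by simp
    then have "\<bar>(\<Sum>i<2 ^ n. z (p n i) * h (q n i)) / 2 ^ n - integral {0..1} g\<bar>
        = \<bar>\<Sum>i<2 ^ n. z (p n i) * h (q n i) / 2 ^ n - integral {real i / 2 ^ n..real (Suc i) / 2 ^ n} g\<bar>"
      by (simp only: sum_divide_distrib sum_subtractf)
    also have "\<dots> \<le> (\<Sum>i<2 ^ n. \<bar>z (p n i) * h (q n i) / 2 ^ n - integral {real i / 2 ^ n..real (Suc i) / 2 ^ n} g\<bar>)"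
      by (rule sum_abs)
    also have "\<dots> \<le> (\<Sum>i::nat<2 ^ n. (e / 2) / 2 ^ n)" by (intro sum_mono cell) simp
    also have "\<dots> < e" using e by simp
    finally show "norm ((\<Sum>i<2 ^ n. z (p n i) * h (q n i)) / 2 ^ n - integral {0..1} (\<lambda>t. z t * h t)) < e"
      unfolding g_def[abs_def] by simp
  qed
qed

section \<open>Mean value theorems and summation by parts\<close>

lemma mvt_unit_interval:
  fixes u u' :: "real \<Rightarrow> real"
  assumes "\<And>t. t \<in> {0..1} \<Longrightarrow> (u has_real_derivative u' t) (at t within {0..1})"
    and "0 \<le> a" "a < b" "b \<le> 1"
  obtains x where "a < x" "x < b" "u b - u a = (b - a) * u' x"
proof -
  have "\<exists>x\<in>{a<..<b}. u b - u a = u' x * (b - a)"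
  proof (rule mvt_simple[OF assms(3)])
    fix x assume "a \<le> x" "x \<le> b"
    then have "(u has_real_derivative u' x) (at x within {a..b})"
      using assms by (intro DERIV_subset[OF assms(1)]) auto
    then show "(u has_derivative (*) (u' x)) (at x within {a..b})"
      by (simp add: has_field_derivative_def)
  qed
  then show ?thesis using that by (auto simp: mult.commute)
qed

text \<open>The mean value theorem is applied to the first difference t |-> w (t + d) - w t on
  [a - d, a], and then to w' on an interval of length d.\<close>

lemma second_difference:
  fixes w :: "real \<Rightarrow> real"
  assumes w: "\<And>t. t \<in> {0..1} \<Longrightarrow> (w has_real_derivative w' t) (at t within {0..1})"
    and w': "\<And>t. t \<in> {0..1} \<Longrightarrow> (w' has_real_derivative w'' t) (at t within {0..1})"
    and d: "d > 0" and a: "0 \<le> a - d" "a + d \<le> 1"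
  obtains x where "a - d < x" "x < a + d" "w (a + d) - 2 * w a + w (a - d) = d\<^sup>2 * w'' x"
proof -
  define g where "g t = w (t + d) - w t" for t
  have gder: "(g has_real_derivative w' (t + d) - w' t) (at t within {a - d..a})"
    if t: "t \<in> {a - d..a}" for t
    unfolding g_def
  proof (intro derivative_eq_intros)
    show "((\<lambda>t. w (t + d)) has_real_derivative w' (t + d)) (at t within {a - d..a})"
    proof -
      have "(w has_real_derivative w' (t + d)) (at (t + d) within (\<lambda>t. t + d) ` {a - d..a})"
        using t a d by (intro DERIV_subset[OF w]) auto
      moreover have "((\<lambda>t. t + d) has_real_derivative 1) (at t within {a - d..a})"
        by (auto intro!: derivative_eq_intros)
      ultimately show ?thesis
        using DERIV_image_chain[of w "w' (t + d)" "\<lambda>t. t + d" t "{a - d..a}" 1] by (simp add: o_def)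
    qed
    show "(w has_real_derivative w' t) (at t within {a - d..a})"
      using t a d by (intro DERIV_subset[OF w]) auto
  qed auto
  have "\<exists>y\<in>{a - d<..<a}. g a - g (a - d) = (w' (y + d) - w' y) * (a - (a - d))"
    using d gder by (intro mvt_simple) (auto simp: has_field_derivative_def)
  then obtain y where y: "a - d < y" "y < a" "g a - g (a - d) = (w' (y + d) - w' y) * d" by auto
  obtain x where x: "y < x" "x < y + d" "w' (y + d) - w' y = (y + d - y) * w'' x"
    using mvt_unit_interval[OF w', of y "y + d"] y a d by auto
  show ?thesis
  proof (rule that[of x])
    show "w (a + d) - 2 * w a + w (a - d) = d\<^sup>2 * w'' x"
      using y(3) x(3) by (simp add: g_def power2_eq_square algebra_simps)
  qed (use x y d in linarith)+
qed

lemma summation_by_parts: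
  fixes w z :: "nat \<Rightarrow> real"
  assumes "z 0 = 0"
  shows "(\<Sum>i<N. (w (Suc i) - w i) * (z (Suc i) - z i))
    = z N * (w N - w (N - 1)) - (\<Sum>i<N. z i * (w (Suc i) - 2 * w i + w (i - 1)))"
proof (induction N)
  case 0
  then show ?case by simp
next
  case (Suc N)
  then show ?case by (simp add: algebra_simps)
qed

text \<open>Summation by parts moves both differences onto w, so z enters only through its values
  and need not be differentiable.\<close>

lemma dform_tendsto_second_derivative:
  fixes w z :: "real \<Rightarrow> real"
  assumes w: "\<And>t. t \<in> {0..1} \<Longrightarrow> (w has_real_derivative w' t) (at t within {0..1})"
    and w': "\<And>t. t \<in> {0..1} \<Longrightarrow> (w' has_real_derivative w'' t) (at t within {0..1})"
    and w'': "continuous_on {0..1} w''"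
    and z: "continuous_on {0..1} z" "z 0 = 0" "z 1 = 0"
  shows "(\<lambda>n. dform n w z) \<longlonglongrightarrow> - integral {0..1} (\<lambda>t. z t * w'' t)"
proof -
  \<comment> \<open>At \<open>i = 0\<close> there is no symmetric difference, since
    \<open>i - 1\<close> is truncated; that term of the sum is removed by z 0 = 0.\<close>
  define Q where "Q n i x \<longleftrightarrow> x \<in> {0..1} \<and> \<bar>x - real i / 2 ^ n\<bar> \<le> 1 / 2 ^ n \<and>
      (i > 0 \<longrightarrow> w (real (Suc i) / 2 ^ n) - 2 * w (real i / 2 ^ n) + w (real (i - 1) / 2 ^ n) = (1 / 2 ^ n)\<^sup>2 * w'' x)"
    for n i :: nat and x
  have "\<exists>x. Q n i x"
    if i: "i < 2 ^ n" for n i :: nat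
  proof (cases "i = 0")
    case True
    then show ?thesis unfolding Q_def by (intro exI[of _ 0]) simp
  next
    case False
    have le: "real (Suc i) \<le> 2 ^ n" using i by (metis Suc_leI of_nat_le_iff of_nat_numeral of_nat_power)
    have e: "real i / 2 ^ n - 1 / 2 ^ n = real (i - 1) / 2 ^ n" "real i / 2 ^ n + 1 / 2 ^ n = real (Suc i) / 2 ^ n"
      using False by (simp_all add: of_nat_diff diff_divide_distrib add_divide_distrib)
    obtain x where x: "real i / 2 ^ n - 1 / 2 ^ n < x" "x < real i / 2 ^ n + 1 / 2 ^ n"
      "w (real i / 2 ^ n + 1 / 2 ^ n) - 2 * w (real i / 2 ^ n) + w (real i / 2 ^ n - 1 / 2 ^ n) = (1 / 2 ^ n)\<^sup>2 * w'' x"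
    proof (rule second_difference[OF w w', of "1 / 2 ^ n" "real i / 2 ^ n"])
      show "0 \<le> real i / 2 ^ n - 1 / 2 ^ n" unfolding e by simp
      show "real i / 2 ^ n + 1 / 2 ^ n \<le> 1" unfolding e using le by simp
    qed auto
    have "0 \<le> real (i - 1) / 2 ^ n" "real (Suc i) / 2 ^ n \<le> 1" using le by simp_all
    then have "x \<in> {0..1}" using x(1,2) unfolding e atLeastAtMost_iff by linarith
    moreover have "\<bar>x - real i / 2 ^ n\<bar> \<le> 1 / 2 ^ n" using x(1,2) by linarith
    ultimately show ?thesis using x(3) unfolding e Q_def by auto
  qed
  then have "Q n i (SOME x. Q n i x)" if "i < 2 ^ n" for n i using that by (blast intro: someI_ex)
  then obtain q where "\<And>n i. i < 2 ^ n \<Longrightarrow> Q n i (q n i)"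
    using that[of "\<lambda>n i. SOME x. Q n i x"] by blast
  then have q: "q n i \<in> {0..1} \<and> \<bar>q n i - real i / 2 ^ n\<bar> \<le> 1 / 2 ^ n \<and>
      (i > 0 \<longrightarrow> w (real (Suc i) / 2 ^ n) - 2 * w (real i / 2 ^ n) + w (real (i - 1) / 2 ^ n) = (1 / 2 ^ n)\<^sup>2 * w'' (q n i))"
    if "i < 2 ^ n" for n i
    using that unfolding Q_def by blast
  have "dform n w z = - ((\<Sum>i<2 ^ n. z (real i / 2 ^ n) * w'' (q n i)) / 2 ^ n)" for n
  proof -
    have "dform n w z = 2 ^ n * (- (\<Sum>i<2 ^ n. z (real i / 2 ^ n) *
        (w (real (Suc i) / 2 ^ n) - 2 * w (real i / 2 ^ n) + w (real (i - 1) / 2 ^ n))))"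
      unfolding dform_def
      using summation_by_parts[of "\<lambda>i. z (real i / 2 ^ n)" "\<lambda>i. w (real i / 2 ^ n)" "2 ^ n"] z by simp
    also have "(\<Sum>i<2 ^ n. z (real i / 2 ^ n) *
        (w (real (Suc i) / 2 ^ n) - 2 * w (real i / 2 ^ n) + w (real (i - 1) / 2 ^ n)))
      = (\<Sum>i<2 ^ n. z (real i / 2 ^ n) * ((1 / 2 ^ n)\<^sup>2 * w'' (q n i)))"
    proof (rule sum.cong[OF refl])
      fix i :: nat assume "i \<in> {..<2 ^ n}"
      then show "z (real i / 2 ^ n) * (w (real (Suc i) / 2 ^ n) - 2 * w (real i / 2 ^ n) + w (real (i - 1) / 2 ^ n))
          = z (real i / 2 ^ n) * ((1 / 2 ^ n)\<^sup>2 * w'' (q n i))"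
        using q[of i n] z(2) by (cases "i = 0") auto
    qed
    also have "2 ^ n * (- \<dots>) = - ((\<Sum>i<2 ^ n. z (real i / 2 ^ n) * w'' (q n i)) / 2 ^ n)"
      by (simp add: sum_distrib_left sum_divide_distrib sum_negf[symmetric] power2_eq_square field_simps)
    finally show ?thesis .
  qed
  moreover have "(\<lambda>n. (\<Sum>i<2 ^ n. z (real i / 2 ^ n) * w'' (q n i)) / 2 ^ n)
      \<longlonglongrightarrow> integral {0..1} (\<lambda>t. z t * w'' t)"
  proof (rule riemann_product_tendsto[OF z(1) w''])
    fix n i :: nat assume i: "i < 2 ^ n"
    then have "real i \<le> 2 ^ n" by (metis less_imp_le of_nat_le_iff of_nat_numeral of_nat_power)
    then show "real i / 2 ^ n \<in> {0..1} \<and> \<bar>real i / 2 ^ n - real i / 2 ^ n\<bar> \<le> 1 / 2 ^ n" by simp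
    show "q n i \<in> {0..1} \<and> \<bar>q n i - real i / 2 ^ n\<bar> \<le> 1 / 2 ^ n" using q[OF i] by auto
  qed
  ultimately show ?thesis by (simp only: tendsto_minus)
qed

text \<open>Links the dyadic energy to the integral in the equation: each difference quotient is a
  value of w' in its cell.\<close>

lemma dform_tendsto_energy:
  fixes w :: "real \<Rightarrow> real"
  assumes w: "\<And>t. t \<in> {0..1} \<Longrightarrow> (w has_real_derivative w' t) (at t within {0..1})"
    and w': "continuous_on {0..1} w'"
  shows "(\<lambda>n. dform n w w) \<longlonglongrightarrow> integral {0..1} (\<lambda>t. \<bar>w' t\<bar>\<^sup>2)"
proof -
  define Q where "Q n i x \<longleftrightarrow> x \<in> {0..1} \<and> \<bar>x - real i / 2 ^ n\<bar> \<le> 1 / 2 ^ n \<and>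
      w (real (Suc i) / 2 ^ n) - w (real i / 2 ^ n) = 1 / 2 ^ n * w' x"
    for n i :: nat and x
  have "\<exists>x. Q n i x"
    if i: "i < 2 ^ n" for n i :: nat
  proof -
    have le: "real (Suc i) \<le> 2 ^ n" using i by (metis Suc_leI of_nat_le_iff of_nat_numeral of_nat_power)
    have e: "real (Suc i) / 2 ^ n = real i / 2 ^ n + 1 / 2 ^ n" by (simp add: add_divide_distrib)
    have le1: "real (Suc i) / 2 ^ n \<le> 1" using le by simp
    obtain x where x: "real i / 2 ^ n < x" "x < real (Suc i) / 2 ^ n"
      "w (real (Suc i) / 2 ^ n) - w (real i / 2 ^ n) = (real (Suc i) / 2 ^ n - real i / 2 ^ n) * w' x"
      by (rule mvt_unit_interval[OF w _ _ le1, of "real i / 2 ^ n"]) (auto intro: divide_strict_right_mono)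
    have "0 \<le> real i / 2 ^ n" by simp
    then have "x \<in> {0..1}" using x(1,2) le1 unfolding atLeastAtMost_iff by linarith
    moreover have "\<bar>x - real i / 2 ^ n\<bar> \<le> 1 / 2 ^ n" using x(1,2) e by linarith
    ultimately show ?thesis using x(3) e unfolding Q_def by auto
  qed
  then have "Q n i (SOME x. Q n i x)" if "i < 2 ^ n" for n i using that by (blast intro: someI_ex)
  then obtain q where "\<And>n i. i < 2 ^ n \<Longrightarrow> Q n i (q n i)"
    using that[of "\<lambda>n i. SOME x. Q n i x"] by blast
  then have q: "q n i \<in> {0..1} \<and> \<bar>q n i - real i / 2 ^ n\<bar> \<le> 1 / 2 ^ n \<and>
      w (real (Suc i) / 2 ^ n) - w (real i / 2 ^ n) = 1 / 2 ^ n * w' (q n i)"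
    if "i < 2 ^ n" for n i
    using that unfolding Q_def by blast
  have "dform n w w = (\<Sum>i<2 ^ n. w' (q n i) * w' (q n i)) / 2 ^ n" for n
  proof -
    have "dform n w w = 2 ^ n * (\<Sum>i<2 ^ n. (1 / 2 ^ n * w' (q n i)) * (1 / 2 ^ n * w' (q n i)))"
      unfolding dform_def using q by (intro arg_cong[of _ _ "(*) _"] sum.cong) auto
    then show ?thesis by (simp add: sum_distrib_left sum_divide_distrib)
  qed
  moreover have "(\<lambda>n. (\<Sum>i<2 ^ n. w' (q n i) * w' (q n i)) / 2 ^ n) \<longlonglongrightarrow> integral {0..1} (\<lambda>t. w' t * w' t)"
    by (rule riemann_product_tendsto[OF w' w']) (use q in auto)
  ultimately show ?thesis by (simp add: power2_eq_square)
qed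

section \<open>Uniqueness for constant nonlinearities and the weak equation\<close>

text \<open>Cauchy-Schwarz in the form \<integral>(u' - c)^2 \<ge> 0, with c the mean slope over
  [a, b].\<close>

lemma increment_le_integral:
  fixes u :: "real \<Rightarrow> real"
  assumes u: "\<And>t. t \<in> {0..1} \<Longrightarrow> (u has_real_derivative u' t) (at t within {0..1})"
    and u': "continuous_on {0..1} u'" and ab: "0 \<le> a" "a < b" "b \<le> 1"
  shows "(u b - u a)\<^sup>2 \<le> (b - a) * integral {a..b} (\<lambda>s. \<bar>u' s\<bar>\<^sup>2)"
proof -
  define c where "c = (u b - u a) / (b - a)"
  have sub: "{a..b} \<subseteq> {0..1}" using ab by auto
  have ftc: "(u' has_integral (u b - u a)) {a..b}"
    using ab sub by (intro fundamental_theorem_of_calculus)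
      (auto simp: has_real_derivative_iff_has_vector_derivative[symmetric] intro: DERIV_subset[OF u])
  have int: "(\<lambda>s. \<bar>u' s\<bar>\<^sup>2) integrable_on {a..b}"
    by (intro integrable_continuous_interval continuous_intros continuous_on_subset[OF u' sub])
  have "((\<lambda>s. \<bar>u' s\<bar>\<^sup>2 - 2 * c * u' s + c\<^sup>2) has_integral
      integral {a..b} (\<lambda>s. \<bar>u' s\<bar>\<^sup>2) - 2 * c * (u b - u a) + (b - a) * c\<^sup>2) {a..b}"
    using has_integral_add[OF has_integral_diff[OF integrable_integral[OF int]
        has_integral_mult_right[OF ftc, of "2 * c"]] has_integral_const_real[of "c\<^sup>2" a b]] ab
    by simp
  moreover have "0 \<le> \<bar>u' s\<bar>\<^sup>2 - 2 * c * u' s + c\<^sup>2" for s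
    using zero_le_power2[of "u' s - c"] by (simp add: power2_diff algebra_simps)
  ultimately have "0 \<le> integral {a..b} (\<lambda>s. \<bar>u' s\<bar>\<^sup>2) - 2 * c * (u b - u a) + (b - a) * c\<^sup>2"
    by (rule has_integral_nonneg)
  then have "0 \<le> (b - a) * (integral {a..b} (\<lambda>s. \<bar>u' s\<bar>\<^sup>2) - 2 * c * (u b - u a) + (b - a) * c\<^sup>2)"
    using ab by simp
  also have "\<dots> = (b - a) * integral {a..b} (\<lambda>s. \<bar>u' s\<bar>\<^sup>2) - (u b - u a)\<^sup>2"
  proof -
    have "u b - u a = (b - a) * c" unfolding c_def using ab by simp
    then show ?thesis by (simp only:) (simp add: power2_eq_square algebra_simps)
  qed
  finally show ?thesis by simp
qed

text \<open>Let A and B be the energies on [0, t] and [t, 1]. The bounds u(t)^2 \<le> t A and u(t)^2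
  \<le> (1 - t) B, weighted by 1 - t and t, add up to t (1 - t) (A + B), and t (1 - t) \<le> 1 /
  4.\<close>

lemma abs_le_half_sqrt_energy:
  fixes u :: "real \<Rightarrow> real"
  assumes u: "\<And>t. t \<in> {0..1} \<Longrightarrow> (u has_real_derivative u' t) (at t within {0..1})"
    and u': "continuous_on {0..1} u'" and zero: "u 0 = 0" "u 1 = 0" and t: "t \<in> {0..1}"
  shows "\<bar>u t\<bar> \<le> sqrt (integral {0..1} (\<lambda>s. \<bar>u' s\<bar>\<^sup>2)) / 2"
proof -
  define K where "K = integral {0..1} (\<lambda>s. \<bar>u' s\<bar>\<^sup>2)"
  have int: "(\<lambda>s. \<bar>u' s\<bar>\<^sup>2) integrable_on {0..1}"
    by (intro integrable_continuous_interval continuous_intros u')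
  have K: "0 \<le> K" unfolding K_def by (intro integral_nonneg int) simp
  have "(2 * \<bar>u t\<bar>)\<^sup>2 \<le> K"
  proof (cases "t = 0 \<or> t = 1")
    case True
    then show ?thesis using zero K by auto
  next
    case False
    then have t: "0 < t" "t < 1" using t by auto
    define A where "A = integral {0..t} (\<lambda>s. \<bar>u' s\<bar>\<^sup>2)"
    define B where "B = integral {t..1} (\<lambda>s. \<bar>u' s\<bar>\<^sup>2)"
    have AB: "A + B = K"
      unfolding A_def B_def K_def
      by (rule Henstock_Kurzweil_Integration.integral_combine) (use t int in auto)
    have "(u t)\<^sup>2 \<le> t * A"
      using increment_le_integral[OF u u', of 0 t] t zero unfolding A_def by simp
    then have 1: "(1 - t) * (u t)\<^sup>2 \<le> (1 - t) * (t * A)" using t by (intro mult_left_mono) auto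
    have "(u t)\<^sup>2 \<le> (1 - t) * B"
      using increment_le_integral[OF u u', of t 1] t zero unfolding B_def by simp
    then have 2: "t * (u t)\<^sup>2 \<le> t * ((1 - t) * B)" using t by (intro mult_left_mono) auto
    have "(u t)\<^sup>2 \<le> t * (1 - t) * K" using 1 2 unfolding AB[symmetric] by (simp add: algebra_simps)
    also have "t * (1 - t) * K \<le> 1 / 4 * K"
      using zero_le_power2[of "t - 1 / 2"] K
      by (intro mult_right_mono) (simp_all add: power2_eq_square algebra_simps)
    finally show ?thesis by simp
  qed
  then have "2 * \<bar>u t\<bar> \<le> sqrt K" by (rule real_le_rsqrt)
  then show ?thesis unfolding K_def by simp
qed

lemma C0_apply_continuous: "continuous_on {0..1} (C0_apply a)"
  using C0_apply[of a] by simp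

locale kirchhoff =
  fixes f \<omega> :: "real \<Rightarrow> real" and \<rho> :: real
  assumes f_cont: "continuous_on UNIV f" and \<rho>_pos: "0 < \<rho>"
    and \<omega>_cont: "continuous_on {0..<\<rho>} \<omega>"
    and \<omega>_nonneg: "\<And>x. 0 \<le> x \<Longrightarrow> x < \<rho> \<Longrightarrow> 0 \<le> \<omega> x"
    and \<omega>_strict: "\<And>x y. 0 \<le> x \<Longrightarrow> x < y \<Longrightarrow> y < \<rho> \<Longrightarrow> \<omega> x < \<omega> y"
    and \<omega>_coercive: "filterlim (\<lambda>\<xi>. integral {0..\<xi>} \<omega>) at_top (at_left \<rho>)"
begin

lemma \<omega>_eq_0: "0 \<le> x \<Longrightarrow> x < \<rho> \<Longrightarrow> \<omega> x = 0 \<Longrightarrow> x = 0"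
  using \<omega>_strict[of 0 x] \<omega>_nonneg[of 0] \<rho>_pos by (cases "x = 0") auto

text \<open>For constant \<open>f = c\<close> the equation reads \<open>- \<omega>(K) u'' = h\<close> with \<open>h = c \<beta> + \<alpha>\<close> independent
  of \<open>u\<close>, so \<open>\<omega>(K) u'\<close> and hence \<open>\<omega>(K)\<^sup>2 K\<close> are determined by \<open>h\<close>; the latter is strictly
  increasing in \<open>K\<close>.\<close>

lemma constant_imp_unique:
  assumes const: "\<And>x. x \<in> {- (sqrt \<rho> / 2)..sqrt \<rho> / 2} \<Longrightarrow> f x = c"
    and u: "classical_solution f \<rho> \<omega> \<alpha> \<beta> u" and v: "classical_solution f \<rho> \<omega> \<alpha> \<beta> v"
    and t: "t \<in> {0..1}"
  shows "u t = v t"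
proof -
  have props: "\<exists>u' u''. (\<forall>t\<in>{0..1}. (u has_real_derivative u' t) (at t within {0..1})) \<and>
     (\<forall>t\<in>{0..1}. (u' has_real_derivative u'' t) (at t within {0..1})) \<and> continuous_on {0..1} u' \<and>
     (\<forall>t\<in>{0..1}. \<omega> (integral {0..1} (\<lambda>s. \<bar>u' s\<bar>\<^sup>2)) * u'' t = - (C0_apply \<beta> t * c + C0_apply \<alpha> t)) \<and>
     u 0 = 0 \<and> u 1 = 0 \<and> integral {0..1} (\<lambda>s. \<bar>u' s\<bar>\<^sup>2) < \<rho> \<and> 0 \<le> integral {0..1} (\<lambda>s. \<bar>u' s\<bar>\<^sup>2) \<and>
     (\<forall>t\<in>{0..1}. \<bar>u t\<bar> \<le> sqrt (integral {0..1} (\<lambda>s. \<bar>u' s\<bar>\<^sup>2)) / 2)"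
    if sol: "classical_solution f \<rho> \<omega> \<alpha> \<beta> u" for u
  proof -
    obtain u' u'' where d: "\<And>t. t \<in> {0..1} \<Longrightarrow> (u has_real_derivative u' t) (at t within {0..1})"
      "\<And>t. t \<in> {0..1} \<Longrightarrow> (u' has_real_derivative u'' t) (at t within {0..1})"
      and eq: "\<And>t. t \<in> {0..1} \<Longrightarrow> - \<omega> (integral {0..1} (\<lambda>s. \<bar>u' s\<bar>\<^sup>2)) * u'' t
                      = C0_apply \<beta> t * f (u t) + C0_apply \<alpha> t"
      and b: "u 0 = 0" "u 1 = 0" "integral {0..1} (\<lambda>s. \<bar>u' s\<bar>\<^sup>2) < \<rho>"
      using sol unfolding classical_solution_def C2_derivs_def by blast
    have cont: "continuous_on {0..1} u'" using d(2) by (rule DERIV_continuous_on)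
    have nn: "0 \<le> integral {0..1} (\<lambda>s. \<bar>u' s\<bar>\<^sup>2)"
      by (intro integral_nonneg integrable_continuous_interval continuous_intros cont) simp
    have bound: "\<bar>u t\<bar> \<le> sqrt (integral {0..1} (\<lambda>s. \<bar>u' s\<bar>\<^sup>2)) / 2" if "t \<in> {0..1}" for t
      by (rule abs_le_half_sqrt_energy[OF d(1) cont b(1,2) that])
    have "f (u t) = c" if "t \<in> {0..1}" for t
    proof (rule const)
      have "sqrt (integral {0..1} (\<lambda>s. \<bar>u' s\<bar>\<^sup>2)) \<le> sqrt \<rho>" using b(3) by simp
      then show "u t \<in> {- (sqrt \<rho> / 2)..sqrt \<rho> / 2}" using bound[OF that] unfolding atLeastAtMost_iff by linarith
    qed
    then have "\<omega> (integral {0..1} (\<lambda>s. \<bar>u' s\<bar>\<^sup>2)) * u'' t = - (C0_apply \<beta> t * c + C0_apply \<alpha> t)"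
      if "t \<in> {0..1}" for t using eq[OF that] that by simp
    then show ?thesis using d cont b nn bound by blast
  qed
  obtain u' u'' where u: "\<And>t. t \<in> {0..1} \<Longrightarrow> (u has_real_derivative u' t) (at t within {0..1})"
     "\<And>t. t \<in> {0..1} \<Longrightarrow> (u' has_real_derivative u'' t) (at t within {0..1})" "continuous_on {0..1} u'"
     "\<And>t. t \<in> {0..1} \<Longrightarrow> \<omega> (integral {0..1} (\<lambda>s. \<bar>u' s\<bar>\<^sup>2)) * u'' t = - (C0_apply \<beta> t * c + C0_apply \<alpha> t)"
     "u 0 = 0" "u 1 = 0" "integral {0..1} (\<lambda>s. \<bar>u' s\<bar>\<^sup>2) < \<rho>" "0 \<le> integral {0..1} (\<lambda>s. \<bar>u' s\<bar>\<^sup>2)"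
     "\<bar>u t\<bar> \<le> sqrt (integral {0..1} (\<lambda>s. \<bar>u' s\<bar>\<^sup>2)) / 2"
    using props[OF u] t by blast
  obtain v' v'' where v: "\<And>t. t \<in> {0..1} \<Longrightarrow> (v has_real_derivative v' t) (at t within {0..1})"
     "\<And>t. t \<in> {0..1} \<Longrightarrow> (v' has_real_derivative v'' t) (at t within {0..1})" "continuous_on {0..1} v'"
     "\<And>t. t \<in> {0..1} \<Longrightarrow> \<omega> (integral {0..1} (\<lambda>s. \<bar>v' s\<bar>\<^sup>2)) * v'' t = - (C0_apply \<beta> t * c + C0_apply \<alpha> t)"
     "v 0 = 0" "v 1 = 0" "integral {0..1} (\<lambda>s. \<bar>v' s\<bar>\<^sup>2) < \<rho>" "0 \<le> integral {0..1} (\<lambda>s. \<bar>v' s\<bar>\<^sup>2)"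
     "\<bar>v t\<bar> \<le> sqrt (integral {0..1} (\<lambda>s. \<bar>v' s\<bar>\<^sup>2)) / 2"
    using props[OF v] t by blast
  define K where "K = integral {0..1} (\<lambda>s. \<bar>u' s\<bar>\<^sup>2)"
  define K' where "K' = integral {0..1} (\<lambda>s. \<bar>v' s\<bar>\<^sup>2)"
  note u = u[folded K_def] and v = v[folded K'_def]
  \<comment> \<open>Both terms have second derivative - (c \<beta> + \<alpha>) and vanish at 0 and
    1, so g is affine with zero end values, hence zero.\<close>
  define g where "g t = \<omega> K * u t - \<omega> K' * v t" for t
  define g' where "g' t = \<omega> K * u' t - \<omega> K' * v' t" for t
  have g: "(g has_real_derivative g' t) (at t within {0..1})" if "t \<in> {0..1}" for t
    unfolding g_def g'_def by (intro DERIV_diff DERIV_cmult u v that)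
  have "(g' has_real_derivative 0) (at t within {0..1})" if "t \<in> {0..1}" for t
  proof -
    have "(g' has_real_derivative \<omega> K * u'' t - \<omega> K' * v'' t) (at t within {0..1})"
      unfolding g'_def by (intro DERIV_diff DERIV_cmult u v that)
    then show ?thesis using u(4)[OF that] v(4)[OF that] by simp
  qed
  then obtain C where C: "\<And>t. t \<in> {0..1} \<Longrightarrow> g' t = C"
    using has_field_derivative_zero_constant[of "{0..1}" g'] by auto
  obtain x where "0 < x" "x < 1" "g 1 - g 0 = (1 - 0) * g' x"
    using mvt_unit_interval[OF g, of 0 1] by auto
  then have C0: "C = 0" using C[of x] u(5,6) v(5,6) by (simp add: g_def)
  have eq': "\<omega> K * u' t = \<omega> K' * v' t" if "t \<in> {0..1}" for t
    using C[OF that] C0 by (simp add: g'_def)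
  have eq: "\<omega> K * u t = \<omega> K' * v t"
  proof (cases "t = 0")
    case False
    then obtain x where "0 < x" "x < t" "g t - g 0 = (t - 0) * g' x"
      using mvt_unit_interval[OF g, of 0 t] t by auto
    then show ?thesis using C[of x] C0 t u(5) v(5) by (simp add: g_def)
  qed (simp add: u v)
  have KK: "(\<omega> K)\<^sup>2 * K = (\<omega> K')\<^sup>2 * K'"
  proof -
    have "(\<omega> K)\<^sup>2 * K = integral {0..1} (\<lambda>s. (\<omega> K * u' s)\<^sup>2)"
      unfolding K_def by (simp add: power_mult_distrib)
    also have "\<dots> = integral {0..1} (\<lambda>s. (\<omega> K' * v' s)\<^sup>2)"
      by (rule Henstock_Kurzweil_Integration.integral_cong) (simp add: eq')
    also have "\<dots> = (\<omega> K')\<^sup>2 * K'"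
      unfolding K'_def by (simp add: power_mult_distrib)
    finally show ?thesis .
  qed
  have less: "(\<omega> a)\<^sup>2 * a < (\<omega> b)\<^sup>2 * b" if "0 \<le> a" "a < b" "b < \<rho>" for a b
  proof -
    have w: "0 \<le> \<omega> a" "\<omega> a < \<omega> b" using \<omega>_nonneg \<omega>_strict that by auto
    have "(\<omega> a)\<^sup>2 * a \<le> (\<omega> a)\<^sup>2 * b" using that by (intro mult_left_mono) auto
    also have "\<dots> < (\<omega> b)\<^sup>2 * b" using w that by (intro mult_strict_right_mono power_strict_mono) auto
    finally show ?thesis .
  qed
  have "K = K'"
    using less[of K K'] less[of K' K] KK u(7,8) v(7,8) by (cases K K' rule: linorder_cases) auto
  show ?thesis
  \<comment> \<open>If the coefficient vanishes, \<open>eq\<close> says nothing; but then K = 0 and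
    the supremum bound makes both solutions zero.\<close>
  proof (cases "\<omega> K = 0")
    case True
    then have "K = 0" using \<omega>_eq_0 u(7,8) by blast
    then show ?thesis using u(9) v(9) \<open>K = K'\<close> by simp
  next
    case False
    then show ?thesis using eq \<open>K = K'\<close> by simp
  qed
qed

section \<open>The energy functional and its weak Euler-Lagrange equation\<close>

definition Om :: "real \<Rightarrow> real" where
  "Om x = integral {0..x} \<omega>"

lemma Om_has_derivative:
  assumes x: "x \<in> {0..<\<rho>}"
  shows "(Om has_real_derivative \<omega> x) (at x within {0..<\<rho>})"
proof -
  \<comment> \<open>As \<omega> may blow up at \<rho>, the fundamental theorem is applied on a
    compact {0..b} that is still a neighbourhood of x relative to {0..<\<rho>}.\<close>
  obtain b where b: "x < b" "b < \<rho>" using x dense[of x \<rho>] by auto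
  have "continuous_on {0..b} \<omega>" using b by (intro continuous_on_subset[OF \<omega>_cont]) auto
  then have "(Om has_real_derivative \<omega> x) (at x within {0..b})"
    unfolding Om_def[abs_def] using x b by (intro integral_has_real_derivative) auto
  moreover have "at x within {0..<\<rho>} = at x within {0..b}"
    by (rule at_within_nhd[of x "{..<b}"]) (use b in auto)
  ultimately show ?thesis by simp
qed

lemma Om_continuous: "continuous_on {0..<\<rho>} Om"
  by (rule DERIV_continuous_on[OF Om_has_derivative])

lemma Om_mono:
  assumes "0 \<le> x" "x \<le> y" "y < \<rho>"
  shows "Om x \<le> Om y"
  unfolding Om_def
proof (rule integral_subset_le)
  show "\<omega> integrable_on {0..x}" "\<omega> integrable_on {0..y}"
    using assms by (auto intro!: integrable_continuous_interval continuous_on_subset[OF \<omega>_cont])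
qed (use assms \<omega>_nonneg in auto)

text \<open>Some antiderivative on the whole line; \<open>integral {0..x} f\<close> would be 0 for
  negative x. For fixed \<beta>, a different choice shifts all values of the functional
  equally.\<close>

definition F :: "real \<Rightarrow> real" where
  "F = (SOME F. \<forall>x. (F has_real_derivative f x) (at x))"

lemma F_has_derivative: "(F has_real_derivative f x) (at x)"
proof -
  have "\<exists>F. \<forall>x::real. -\<infinity> < ereal x \<longrightarrow> ereal x < \<infinity> \<longrightarrow> (F has_vector_derivative f x) (at x)"
    using f_cont by (intro einterval_antiderivative) (auto simp: continuous_on_eq_continuous_at)
  then have "\<exists>F. \<forall>x. (F has_real_derivative f x) (at x)"
    by (simp add: has_real_derivative_iff_has_vector_derivative)
  then have "\<forall>x. (F has_real_derivative f x) (at x)"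
    unfolding F_def by (rule someI_ex)
  then show ?thesis by blast
qed

lemma F_continuous: "continuous_on A F"
  by (rule DERIV_continuous_on[OF DERIV_subset[OF F_has_derivative subset_UNIV]])

definition potential :: "(real \<Rightarrow> real) \<Rightarrow> C0_unit \<times> C0_unit \<Rightarrow> real" where
  "potential u p = integral {0..1} (\<lambda>t. C0_apply (fst p) t * u t + C0_apply (snd p) t * F (u t))"

lemma potential_has_derivative:
  assumes u: "continuous_on UNIV u" and z: "continuous_on UNIV z"
  shows "((\<lambda>s. potential (\<lambda>t. u t + s * z t) p) has_real_derivative
     integral {0..1} (\<lambda>t. (C0_apply (fst p) t + C0_apply (snd p) t * f (u t)) * z t)) (at 0)"
proof -
  have cu: "continuous_on A (\<lambda>x. u (snd x))" and cz: "continuous_on A (\<lambda>x. z (snd x))" for A :: "(real \<times> real) set"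
    by (intro continuous_on_compose2[OF u] continuous_on_compose2[OF z] continuous_intros; simp)+
  have ca: "continuous_on (UNIV \<times> cbox 0 1) (\<lambda>x::real \<times> real. C0_apply a (snd x))" for a
    by (intro continuous_on_compose2[OF C0_apply_continuous] continuous_intros) auto
  have "((\<lambda>s. integral (cbox 0 1) (\<lambda>t. C0_apply (fst p) t * (u t + s * z t) + C0_apply (snd p) t * F (u t + s * z t)))
      has_field_derivative integral (cbox 0 1) (\<lambda>t. (C0_apply (fst p) t + C0_apply (snd p) t * f (u t + 0 * z t)) * z t))
      (at 0 within UNIV)"
  proof (rule leibniz_rule_field_derivative)
    show "((\<lambda>s. C0_apply (fst p) t * (u t + s * z t) + C0_apply (snd p) t * F (u t + s * z t)) has_field_derivative
        (C0_apply (fst p) t + C0_apply (snd p) t * f (u t + s * z t)) * z t) (at s within UNIV)" for s t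
      by (rule derivative_eq_intros DERIV_chain2[OF F_has_derivative] refl | simp add: algebra_simps)+
    show "(\<lambda>t. C0_apply (fst p) t * (u t + s * z t) + C0_apply (snd p) t * F (u t + s * z t)) integrable_on cbox 0 1" for s
      by (intro integrable_continuous continuous_intros continuous_on_compose2[OF F_continuous]
          continuous_on_subset[OF u] continuous_on_subset[OF z]) (auto simp: C0_apply_continuous)
    show "continuous_on (UNIV \<times> cbox 0 1) (\<lambda>(s, t). (C0_apply (fst p) t + C0_apply (snd p) t * f (u t + s * z t)) * z t)"
      unfolding case_prod_unfold
      by (intro continuous_intros continuous_on_compose2[OF f_cont] cu cz ca) auto
  qed auto
  then show ?thesis unfolding potential_def by simp
qed

text \<open>The weak Euler--Lagrange equation. At \<open>u = 0\<close> the chain rule needs \<open>Om\<close> only from the right,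
  since the energy is nonnegative.\<close>

lemma minimizer_weak_equation:
  assumes u: "finite_energy u" "dirichlet u u < \<rho>"
    and min: "\<And>v. finite_energy v \<Longrightarrow> dirichlet v v < \<rho> \<Longrightarrow>
      Om (dirichlet u u) / 2 - potential u p \<le> Om (dirichlet v v) / 2 - potential v p"
    and z: "finite_energy z"
  shows "\<omega> (dirichlet u u) * dirichlet u z
    = integral {0..1} (\<lambda>t. (C0_apply (fst p) t + C0_apply (snd p) t * f (u t)) * z t)"
proof -
  define \<phi> where "\<phi> s = dirichlet u u + 2 * s * dirichlet u z + s\<^sup>2 * dirichlet z z" for s
  have fe: "finite_energy (\<lambda>t. u t + s * z t)" for s
    using finite_energy_lincomb[OF u(1) z, of 1 s] by simp
  have \<phi>: "dirichlet (\<lambda>t. u t + s * z t) (\<lambda>t. u t + s * z t) = \<phi> s" for s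
    using dirichlet_lincomb[OF u(1) z, of 1 s] by (simp add: \<phi>_def)
  have \<phi>0: "0 \<le> \<phi> s" for s using dirichlet_nonneg[OF fe] \<phi> by metis
  have "isCont \<phi> 0" unfolding \<phi>_def by (intro continuous_intros)
  then have "\<phi> \<midarrow>0\<rightarrow> \<phi> 0" by (simp add: isCont_def)
  moreover have "\<phi> 0 < \<rho>" using u(2) by (simp add: \<phi>_def)
  ultimately have "\<forall>\<^sub>F s in at 0. \<phi> s < \<rho>" by (rule order_tendstoD)
  then obtain d where d: "d > 0" "\<And>s. s \<noteq> 0 \<Longrightarrow> dist s 0 < d \<Longrightarrow> \<phi> s < \<rho>"
    unfolding eventually_at by auto
  have small: "\<phi> s < \<rho>" if "\<bar>s\<bar> < d" for s
    using d(2)[of s] that \<open>\<phi> 0 < \<rho>\<close> by (cases "s = 0") auto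
  have "(\<phi> has_real_derivative 2 * dirichlet u z) (at 0)"
    unfolding \<phi>_def by (auto intro!: derivative_eq_intros)
  then have "(\<phi> has_real_derivative 2 * dirichlet u z) (at 0 within {-d<..<d})"
    by (rule DERIV_subset) simp
  moreover have "(Om has_real_derivative \<omega> (\<phi> 0)) (at (\<phi> 0) within \<phi> ` {-d<..<d})"
    by (rule DERIV_subset[OF Om_has_derivative]) (use \<phi>0 small \<open>\<phi> 0 < \<rho>\<close> in auto)
  ultimately have "(Om \<circ> \<phi> has_real_derivative \<omega> (\<phi> 0) * (2 * dirichlet u z)) (at 0 within {-d<..<d})"
    by (intro DERIV_image_chain)
  then have "(Om \<circ> \<phi> has_real_derivative \<omega> (\<phi> 0) * (2 * dirichlet u z)) (at 0)"
    using d(1) at_within_open[of 0 "{-d<..<d}"] by simp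
  then have "((\<lambda>s. Om (\<phi> s) / 2 - potential (\<lambda>t. u t + s * z t) p) has_real_derivative
      \<omega> (\<phi> 0) * (2 * dirichlet u z) / 2
      - integral {0..1} (\<lambda>t. (C0_apply (fst p) t + C0_apply (snd p) t * f (u t)) * z t)) (at 0)"
    by (intro DERIV_diff DERIV_cdivide potential_has_derivative finite_energyD u z) (simp add: o_def)
  then have "\<omega> (\<phi> 0) * (2 * dirichlet u z) / 2
      - integral {0..1} (\<lambda>t. (C0_apply (fst p) t + C0_apply (snd p) t * f (u t)) * z t) = 0"
  proof (rule DERIV_local_min[OF _ d(1)], intro allI impI)
    fix s :: real assume "\<bar>0 - s\<bar> < d"
    then show "Om (\<phi> 0) / 2 - potential (\<lambda>t. u t + 0 * z t) p \<le> Om (\<phi> s) / 2 - potential (\<lambda>t. u t + s * z t) p"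
      using min[OF fe[of s]] small[of s] by (simp add: \<phi>) (simp add: \<phi>_def)
  qed
  then show ?thesis by (simp add: \<phi>_def)
qed

end

section \<open>Regularity of minimisers and compactness\<close>

lemma finite_energy_C1:
  assumes w: "\<And>t. t \<in> {0..1} \<Longrightarrow> (w has_real_derivative w' t) (at t within {0..1})"
    and w': "continuous_on {0..1} w'" and cont: "continuous_on UNIV w"
    and zero: "\<And>t. t \<notin> {0<..<1} \<Longrightarrow> w t = 0"
  shows "finite_energy w"
  unfolding finite_energy_def
proof (intro conjI allI impI)
  have "Bseq (\<lambda>n. dform n w w)"
    using dform_tendsto_energy[OF w w'] by (intro convergent_imp_Bseq convergentI)
  then show "bdd_above (range (\<lambda>n. dform n w w))"
    by (rule Bseq_bdd_above)
qed (use cont zero in auto)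

lemma dirichlet_problem:
  fixes h :: "real \<Rightarrow> real"
  assumes h: "continuous_on {0..1} h"
  obtains w w' where "finite_energy w" "continuous_on {0..1} w'"
    "\<And>t. t \<in> {0..1} \<Longrightarrow> (w has_real_derivative w' t) (at t within {0..1})"
    "\<And>t. t \<in> {0..1} \<Longrightarrow> (w' has_real_derivative - h t) (at t within {0..1})"
proof -
  define H1 where "H1 t = integral {0..t} h" for t
  define H2 where "H2 t = integral {0..t} H1" for t
  have H1: "(H1 has_real_derivative h t) (at t within {0..1})" if "t \<in> {0..1}" for t
    unfolding H1_def by (rule integral_has_real_derivative[OF h that])
  have "continuous_on {0..1} H1" by (rule DERIV_continuous_on[OF H1])
  then have H2: "(H2 has_real_derivative H1 t) (at t within {0..1})" if "t \<in> {0..1}" for t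
    unfolding H2_def by (rule integral_has_real_derivative[OF _ that])
  \<comment> \<open>The linear term makes v vanish at 1 as well as at 0; clamping the argument then
    extends it continuously by zero, as \<open>finite_energy\<close> demands.\<close>
  define v where "v t = t * H2 1 - H2 t" for t
  define w where "w t = v (max 0 (min 1 t))" for t
  define w' where "w' t = H2 1 - H1 t" for t
  have v: "(v has_real_derivative w' t) (at t within {0..1})" if "t \<in> {0..1}" for t
    unfolding v_def w'_def by (auto intro!: derivative_eq_intros H2 that)
  have w: "(w has_real_derivative w' t) (at t within {0..1})" if "t \<in> {0..1}" for t
    by (rule has_field_derivative_transform_within[OF v[OF that] zero_less_one that])
      (auto simp: w_def max_def min_def)
  have w': "(w' has_real_derivative - h t) (at t within {0..1})" if "t \<in> {0..1}" for t
    unfolding w'_def by (auto intro!: derivative_eq_intros H1 that)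
  have cw': "continuous_on {0..1} w'" by (rule DERIV_continuous_on[OF w'])
  have "continuous_on UNIV w"
    unfolding w_def
    by (intro continuous_on_compose2[OF DERIV_continuous_on[OF v]] continuous_intros) auto
  moreover have "w t = 0" if "t \<notin> {0<..<1}" for t
    using that by (cases "t \<le> 0") (auto simp: w_def v_def H2_def)
  ultimately have "finite_energy w" using finite_energy_C1[OF w cw'] by blast
  then show ?thesis using that w w' cw' by blast
qed

lemma zero_derivative_within:
  fixes w :: "real \<Rightarrow> real"
  assumes "\<And>t. t \<in> {0..1} \<Longrightarrow> w t = 0" and t: "t \<in> {0..1}"
    and w: "(w has_real_derivative d) (at t within {0..1})"
  shows "d = 0"
proof -
  have "((\<lambda>_. 0) has_real_derivative d) (at t within {0..1})"
    by (rule has_field_derivative_transform_within[OF w zero_less_one t]) (use assms in auto)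
  moreover have "((\<lambda>_. 0) has_real_derivative 0) (at t within {0..1})" by simp
  ultimately show ?thesis
    using vector_derivative_unique_within_closed_interval[of 0 1 t "\<lambda>_. 0" d 0] t
    by (simp add: has_real_derivative_iff_has_vector_derivative)
qed

context kirchhoff
begin

text \<open>With \<open>w\<close> the solution of \<open>- w'' = h\<close> for \<open>h = \<beta> f(u) + \<alpha>\<close>, the function \<open>\<omega>(E(u)) u - w\<close>
  is orthogonal to all functions of finite energy, in particular to itself.\<close>

lemma minimizer_is_solution:
  assumes u: "finite_energy u" "dirichlet u u < \<rho>"
    and min: "\<And>v. finite_energy v \<Longrightarrow> dirichlet v v < \<rho> \<Longrightarrow>
      Om (dirichlet u u) / 2 - potential u (\<alpha>, \<beta>) \<le> Om (dirichlet v v) / 2 - potential v (\<alpha>, \<beta>)"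
  shows "classical_solution f \<rho> \<omega> \<alpha> \<beta> u"
proof -
  define E where "E = dirichlet u u"
  define h where "h t = C0_apply \<alpha> t + C0_apply \<beta> t * f (u t)" for t
  have weak: "\<omega> E * dirichlet u z = integral {0..1} (\<lambda>t. h t * z t)" if "finite_energy z" for z
    using minimizer_weak_equation[OF u min that] unfolding E_def h_def by simp
  have h: "continuous_on {0..1} h" unfolding h_def
    by (intro continuous_intros C0_apply_continuous continuous_on_compose2[OF f_cont] finite_energyD(1)[OF u(1)]) simp
  obtain w w' where w: "finite_energy w" "continuous_on {0..1} w'"
    "\<And>t. t \<in> {0..1} \<Longrightarrow> (w has_real_derivative w' t) (at t within {0..1})"
    "\<And>t. t \<in> {0..1} \<Longrightarrow> (w' has_real_derivative - h t) (at t within {0..1})"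
    using dirichlet_problem[OF h] by blast
  have wz: "dirichlet w z = integral {0..1} (\<lambda>t. h t * z t)" if z: "finite_energy z" for z
  proof (rule LIMSEQ_unique[OF dirichlet_tendsto[OF w(1) z]])
    have "(\<lambda>n. dform n w z) \<longlonglongrightarrow> - integral {0..1} (\<lambda>t. z t * (- h t))"
      by (rule dform_tendsto_second_derivative[OF w(3,4)])
        (auto intro!: continuous_intros h finite_energyD[OF z])
    then show "(\<lambda>n. dform n w z) \<longlonglongrightarrow> integral {0..1} (\<lambda>t. h t * z t)" by (simp add: mult.commute)
  qed
  define z where "z t = \<omega> E * u t + (-1) * w t" for t
  have z: "finite_energy z" unfolding z_def by (intro finite_energy_lincomb u w)
  have "dirichlet z z = \<omega> E * dirichlet u z + (-1) * dirichlet w z"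
    unfolding z_def[abs_def] by (rule dirichlet_lincomb_left) (use u w z in \<open>auto simp: z_def[abs_def]\<close>)
  then have "dirichlet z z = 0" using weak[OF z] wz[OF z] by simp
  then have uw: "\<omega> E * u t = w t" for t using dirichlet_eq_0[OF z, of t] by (simp add: z_def)
  have E0: "0 \<le> E" "E < \<rho>" using dirichlet_nonneg u unfolding E_def by auto
  have "\<exists>u' u''. C2_derivs u u' u'' \<and> (\<forall>t\<in>{0..1}. - \<omega> E * u'' t = h t)"
  proof (cases "\<omega> E = 0")
    \<comment> \<open>Degenerate case: u = 0 and w = 0, so h = - w'' = 0 on [0,1], and the equation
      reads 0 = 0 with u'' = 0.\<close>
    case True
    have "u t = 0" for t
      using \<omega>_eq_0[OF E0 True] dirichlet_eq_0[OF u(1)] unfolding E_def by blast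
    then have "u = (\<lambda>_. 0)" by auto
    then have "C2_derivs u (\<lambda>_. 0) (\<lambda>_. 0)" unfolding C2_derivs_def by auto
    moreover have w'0: "w' t = 0" if "t \<in> {0..1}" for t
      using zero_derivative_within[of w, OF _ that w(3)[OF that]] uw True by simp
    have "h t = 0" if "t \<in> {0..1}" for t
      using zero_derivative_within[of w', OF w'0 that w(4)[OF that]] by simp
    ultimately show ?thesis using True by force
  next
    case False
    have ueq: "u = (\<lambda>t. w t / \<omega> E)" using uw False by (auto simp: field_simps fun_eq_iff)
    have "C2_derivs u (\<lambda>t. w' t / \<omega> E) (\<lambda>t. - h t / \<omega> E)"
      unfolding C2_derivs_def
    proof (intro conjI ballI)
      show "(u has_real_derivative w' t / \<omega> E) (at t within {0..1})" if "t \<in> {0..1}" for t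
        unfolding ueq by (intro DERIV_cdivide w that)
      show "((\<lambda>t. w' t / \<omega> E) has_real_derivative - h t / \<omega> E) (at t within {0..1})" if "t \<in> {0..1}" for t
        by (intro DERIV_cdivide w that)
      show "continuous_on {0..1} (\<lambda>t. - h t / \<omega> E)" by (intro continuous_intros h) (use False in auto)
    qed
    then show ?thesis using False by (intro exI conjI) auto
  qed
  then obtain u' u'' where C2: "C2_derivs u u' u''" and eq: "\<And>t. t \<in> {0..1} \<Longrightarrow> - \<omega> E * u'' t = h t"
    by blast
  \<comment> \<open>Only now that u is known to be C^2 can the dyadic energy be replaced by the
    integral in the definition of a solution.\<close>
  have "E = integral {0..1} (\<lambda>s. \<bar>u' s\<bar>\<^sup>2)"
    unfolding E_def
  proof (rule LIMSEQ_unique[OF dirichlet_tendsto[OF u(1) u(1)] dform_tendsto_energy])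
    show "(u has_real_derivative u' t) (at t within {0..1})" if "t \<in> {0..1}" for t
      using C2 that by (simp add: C2_derivs_def)
    show "continuous_on {0..1} u'"
      using C2 by (intro DERIV_continuous_on[of _ _ u'']) (simp add: C2_derivs_def)
  qed
  then show ?thesis
    unfolding classical_solution_def
    using C2 eq E0(2) finite_energyD(2)[OF u(1), of 0] finite_energyD(2)[OF u(1), of 1]
    by (intro exI[of _ u'] exI[of _ u'']) (auto simp: h_def)
qed

end

section \<open>Compactness of energy-bounded sequences\<close>

lemma finite_energy_limit:
  assumes u: "\<And>k. finite_energy (u k)" and lim: "\<And>t. (\<lambda>k. u k t) \<longlonglongrightarrow> l t"
    and cont: "continuous_on UNIV l" and e: "(\<lambda>k. dirichlet (u k) (u k)) \<longlonglongrightarrow> e"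
  shows "finite_energy l" "dirichlet l l \<le> e"
proof -
  have le: "dform n l l \<le> e" for n
  proof (rule LIMSEQ_le[OF _ e])
    show "(\<lambda>k. dform n (u k) (u k)) \<longlonglongrightarrow> dform n l l"
      unfolding dform_def by (intro tendsto_intros lim)
    show "\<exists>N. \<forall>k\<ge>N. dform n (u k) (u k) \<le> dirichlet (u k) (u k)"
      using dform_le_dirichlet[OF u] by blast
  qed
  have "l t = 0" if "t \<notin> {0<..<1}" for t
    using lim[of t] finite_energyD(2)[OF u that] by (simp add: LIMSEQ_const_iff)
  then show l: "finite_energy l"
    unfolding finite_energy_def using cont le by (auto simp: bdd_above_def)
  show "dirichlet l l \<le> e"
    by (rule LIMSEQ_le_const2[OF dirichlet_tendsto[OF l l]]) (use le in auto)
qed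

lemma finite_energy_bcontfun:
  assumes "finite_energy u"
  shows "u \<in> bcontfun"
  using assms abs_le_dirichlet[OF assms]
  by (intro bcontfun_normI[where b = "sqrt (dirichlet u u)"]) (auto simp: finite_energy_def)

text \<open>An energy bound gives a common Hoelder-1/2 modulus, so Arzela-Ascoli applies. The limit
  \<open>e\<close> of the energies is kept apart from the energy of the limit, since energy can be
  lost on the way.\<close>

lemma bounded_energy_subsequence:
  fixes u :: "nat \<Rightarrow> real \<Rightarrow>\<^sub>C real"
  assumes u: "\<And>k. finite_energy (u k)" and \<kappa>: "\<And>k. dirichlet (u k) (u k) \<le> \<kappa>"
  obtains r l e where "strict_mono r" "(u \<circ> r) \<longlonglongrightarrow> l" "finite_energy l" "e \<le> \<kappa>"
    "(\<lambda>k. dirichlet (u (r k)) (u (r k))) \<longlonglongrightarrow> e" "dirichlet l l \<le> e"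
proof -
  have \<kappa>0: "0 \<le> \<kappa>" using dirichlet_nonneg[OF u] \<kappa> order_trans by blast
  have inc: "\<bar>u k t - u k s\<bar> \<le> sqrt (\<bar>t - s\<bar> * \<kappa>)" if "s \<in> {0..1}" "t \<in> {0..1}" for k s t
    by (rule order_trans[OF abs_increment_le_dirichlet[OF u that]])
      (simp add: mult_left_mono \<kappa>)
  obtain g and r1 :: "nat \<Rightarrow> nat" where r1: "strict_mono r1"
    and unif: "\<And>e. 0 < e \<Longrightarrow> \<exists>N. \<forall>n x. n \<ge> N \<and> x \<in> {0..1} \<longrightarrow> norm (u (r1 n) x - g x) < e"
  proof (rule Arzela_Ascoli[of "{0..1::real}" "\<lambda>k. apply_bcontfun (u k)" "sqrt \<kappa>"])
    show "norm (u k t) \<le> sqrt \<kappa>" for k t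
      by (rule order_trans[of _ "sqrt (dirichlet (u k) (u k))"])
        (use abs_le_dirichlet[OF u] \<kappa> in auto)
    fix x e :: real assume x: "x \<in> {0..1}" and e: "0 < e"
    show "\<exists>d>0. \<forall>n y. y \<in> {0..1} \<and> norm (x - y) < d \<longrightarrow> norm (u n x - u n y) < e"
    \<comment> \<open>This inverts the modulus sqrt (d * \<kappa>) < e; adding 1 guards against
      \<kappa> = 0.\<close>
    proof (intro exI[of _ "e\<^sup>2 / (\<kappa> + 1)"] conjI allI impI)
      fix n y assume y: "y \<in> {0..1} \<and> norm (x - y) < e\<^sup>2 / (\<kappa> + 1)"
      then have "\<bar>x - y\<bar> * (\<kappa> + 1) < e\<^sup>2" using \<kappa>0 by (simp add: pos_less_divide_eq)
      then have "\<bar>x - y\<bar> * \<kappa> < e\<^sup>2" by (simp add: algebra_simps)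
      then have "sqrt (\<bar>x - y\<bar> * \<kappa>) < e" using e by (intro real_less_lsqrt) (auto simp: \<kappa>0)
      then show "norm (u n x - u n y) < e" using inc[of y x n] x y by simp
    qed (use e \<kappa>0 in simp)
  next
    fix g and k :: "nat \<Rightarrow> nat"
    assume "strict_mono k"
      "\<And>e. 0 < e \<Longrightarrow> \<exists>N. \<forall>n x. n \<ge> N \<and> x \<in> {0..1} \<longrightarrow> norm (u (k n) x - g x) < e"
    then show thesis by (rule that)
  qed simp
  \<comment> \<open>Arzela-Ascoli speaks of [0,1] only. All functions vanish elsewhere, so the
    subsequence is Cauchy in the sup metric of the line, whose completeness supplies a limit
    continuous everywhere.\<close>
  have "Cauchy (u \<circ> r1)"
  proof (rule metric_CauchyI)
    fix e :: real assume e: "0 < e"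
    then obtain N where N: "\<And>n x. n \<ge> N \<Longrightarrow> x \<in> {0..1} \<Longrightarrow> norm (u (r1 n) x - g x) < e / 4"
      using unif[of "e / 4"] by auto
    have "dist (u (r1 m)) (u (r1 n)) < e" if "m \<ge> N" "n \<ge> N" for m n
    proof -
      have "dist (u (r1 m) x) (u (r1 n) x) \<le> e / 2" for x
      proof (cases "x \<in> {0..1}")
        case True
        show ?thesis using N[OF that(1) True] N[OF that(2) True] unfolding dist_real_def real_norm_def
          by linarith
      next
        case False
        then have "x \<notin> {0<..<1}" by auto
        then show ?thesis using finite_energyD(2)[OF u, of x] e by simp
      qed
      then have "dist (u (r1 m)) (u (r1 n)) \<le> e / 2" by (rule dist_bound)
      then show ?thesis using e by linarith
    qed
    then show "\<exists>M. \<forall>m\<ge>M. \<forall>n\<ge>M. dist ((u \<circ> r1) m) ((u \<circ> r1) n) < e" by auto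
  qed
  then obtain l where l: "(u \<circ> r1) \<longlonglongrightarrow> l" using Cauchy_convergent convergent_def by blast
  define E where "E k = dirichlet (u (r1 k)) (u (r1 k))" for k
  have "\<forall>k. E k \<in> {0..\<kappa>}" using dirichlet_nonneg[OF u] \<kappa> by (auto simp: E_def)
  then obtain e r2 where r2: "e \<in> {0..\<kappa>}" "strict_mono r2"
    "(E \<circ> r2) \<longlonglongrightarrow> e"
    using seq_compactE[OF compact_imp_seq_compact[OF compact_Icc[of 0 \<kappa>]], of E] by metis
  have r: "strict_mono (r1 \<circ> r2)" using r1 r2(2) by (rule strict_mono_o)
  have lim: "(u \<circ> (r1 \<circ> r2)) \<longlonglongrightarrow> l" using LIMSEQ_subseq_LIMSEQ[OF l r2(2)] by (simp add: o_assoc)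
  have elim: "(\<lambda>k. dirichlet (u ((r1 \<circ> r2) k)) (u ((r1 \<circ> r2) k))) \<longlonglongrightarrow> e" using r2(3) by (simp add: o_def E_def)
  have ptw: "(\<lambda>k. u ((r1 \<circ> r2) k) t) \<longlonglongrightarrow> l t" for t
  proof -
    have "uniform_limit UNIV (\<lambda>k. apply_bcontfun ((u \<circ> (r1 \<circ> r2)) k)) (apply_bcontfun l) sequentially"
      using lim by (rule tendsto_bcontfun_uniform_limit)
    from tendsto_uniform_limitI[OF this, of t] show ?thesis by (simp add: o_def)
  qed
  have lf: "finite_energy l" "dirichlet l l \<le> e"
    using finite_energy_limit[of "\<lambda>k. apply_bcontfun (u ((r1 \<circ> r2) k))", OF u ptw _ elim] by auto
  show ?thesis by (rule that[OF r lim lf(1) _ elim lf(2)]) (use r2(1) in auto)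
qed

section \<open>Existence of two solutions\<close>

lemma dense_pair_functional_unbounded:
  fixes p q :: "real \<Rightarrow> real"
  assumes p: "continuous_on {0..1} p" and q: "continuous_on {0..1} q"
    and nz: "t0 \<in> {0..1}" "p t0 \<noteq> 0 \<or> q t0 \<noteq> 0" and S: "dense_pair S"
  shows "\<exists>y\<in>S. K < integral {0..1} (\<lambda>t. C0_apply (fst y) t * p t + C0_apply (snd y) t * q t)"
proof -
  define V where "V y = integral {0..1} (\<lambda>t. C0_apply (fst y) t * p t + C0_apply (snd y) t * q t)" for y
  define D where "D = integral {0..1} (\<lambda>t. (p t)\<^sup>2 + (q t)\<^sup>2)"
  have int: "(\<lambda>t. C0_apply (fst y) t * p t + C0_apply (snd y) t * q t) integrable_on {0..1}" for y
    by (intro integrable_continuous_interval continuous_intros C0_apply_continuous p q)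
  have cont: "continuous_on {0..1} (\<lambda>t. (p t)\<^sup>2 + (q t)\<^sup>2)" by (intro continuous_intros p q)
  have "D \<noteq> 0"
  proof
    assume "D = 0"
    then have "(p t0)\<^sup>2 + (q t0)\<^sup>2 = 0"
      using integral_eq_0_iff[OF cont] nz(1) unfolding D_def by simp
    then show False using nz(2) by (simp add: sum_power2_eq_zero_iff)
  qed
  \<comment> \<open>Scaled so that N (p, q) gives the value K + 2; an element of S close enough to
    it loses less than 1.\<close>
  define N where "N = (K + 2) / D"
  define C where "C g = C0_abs (\<lambda>t. if t \<in> {0..1} then N * g t else 0)" for g
  have C: "C0_apply (C g) t = N * g t" if "continuous_on {0..1} g" "t \<in> {0..1}" for g t
  proof -
    have "continuous_on {0..1} (\<lambda>t. if t \<in> {0..1} then N * g t else 0) \<longleftrightarrow> continuous_on {0..1} (\<lambda>t. N * g t)"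
      by (rule continuous_on_cong) auto
    then have "C0_apply (C g) = (\<lambda>t. if t \<in> {0..1} then N * g t else 0)"
      unfolding C_def using that(1) by (intro C0_abs_inverse) (auto intro: continuous_intros)
    then show ?thesis using that(2) by simp
  qed
  define y0 where "y0 = (C p, C q)"
  have "V y0 = integral {0..1} (\<lambda>t. N * ((p t)\<^sup>2 + (q t)\<^sup>2))"
    unfolding V_def y0_def using C[OF p] C[OF q]
    by (intro Henstock_Kurzweil_Integration.integral_cong) (simp add: power2_eq_square algebra_simps)
  also have "\<dots> = K + 2" using \<open>D \<noteq> 0\<close> by (simp add: N_def D_def)
  finally have V0: "V y0 = K + 2" .
  obtain B1 where B1: "\<And>t. t \<in> {0..1} \<Longrightarrow> \<bar>p t\<bar> \<le> B1"
    using compact_imp_bounded[OF compact_continuous_image[OF p compact_Icc]]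
    unfolding bounded_iff by (metis imageI real_norm_def)
  obtain B2 where B2: "\<And>t. t \<in> {0..1} \<Longrightarrow> \<bar>q t\<bar> \<le> B2"
    using compact_imp_bounded[OF compact_continuous_image[OF q compact_Icc]]
    unfolding bounded_iff by (metis imageI real_norm_def)
  define B where "B = \<bar>B1\<bar> + \<bar>B2\<bar> + 1"
  have B: "B > 0" "\<And>t. t \<in> {0..1} \<Longrightarrow> \<bar>p t\<bar> \<le> B" "\<And>t. t \<in> {0..1} \<Longrightarrow> \<bar>q t\<bar> \<le> B"
    unfolding B_def using B1 B2 by (auto, fastforce+)
  have bound: "\<bar>V y\<bar> \<le> B * pair_norm y" for y
  proof -
    have i: "(\<lambda>t. \<bar>C0_apply a t\<bar>) integrable_on {0..1}" for a
      by (intro integrable_continuous_interval continuous_intros C0_apply_continuous)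
    have "\<bar>V y\<bar> \<le> integral {0..1} (\<lambda>t. B * (\<bar>C0_apply (fst y) t\<bar> + \<bar>C0_apply (snd y) t\<bar>))"
      unfolding V_def real_norm_def[symmetric]
    proof (rule integral_norm_bound_integral[OF int])
      show "(\<lambda>t. B * (norm (C0_apply (fst y) t) + norm (C0_apply (snd y) t))) integrable_on {0..1}"
        using integrable_on_cmult_left[OF integrable_add[OF i i], of B] by simp
      fix t :: real assume t: "t \<in> {0..1}"
      have "\<bar>C0_apply (fst y) t * p t + C0_apply (snd y) t * q t\<bar>
          \<le> \<bar>C0_apply (fst y) t\<bar> * \<bar>p t\<bar> + \<bar>C0_apply (snd y) t\<bar> * \<bar>q t\<bar>"
        by (metis abs_mult abs_triangle_ineq)
      also have "\<dots> \<le> \<bar>C0_apply (fst y) t\<bar> * B + \<bar>C0_apply (snd y) t\<bar> * B"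
        using B t by (intro add_mono mult_left_mono) auto
      finally show "norm (C0_apply (fst y) t * p t + C0_apply (snd y) t * q t)
          \<le> B * (norm (C0_apply (fst y) t) + norm (C0_apply (snd y) t))" by (simp add: algebra_simps)
    qed
    also have "\<dots> = B * pair_norm y"
      unfolding pair_norm_def by (simp add: Henstock_Kurzweil_Integration.integral_add[OF i i])
    finally show ?thesis .
  qed
  obtain y where y: "y \<in> S" "pair_norm (y - y0) < 1 / B"
    using S B(1) unfolding dense_pair_def by (meson divide_pos_pos zero_less_one)
  have "B * pair_norm (y - y0) < 1" using y(2) B(1) by (simp add: field_simps)
  then have "\<bar>V (y - y0)\<bar> < 1" using bound[of "y - y0"] by linarith
  moreover have "V (y - y0) = V y - V y0"
    unfolding V_def Henstock_Kurzweil_Integration.integral_diff[OF int int, symmetric]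
    by (intro Henstock_Kurzweil_Integration.integral_cong) (simp add: minus_C0_unit.rep_eq algebra_simps)
  ultimately have "K < V y" using V0 by linarith
  then show ?thesis using y(1) unfolding V_def by blast
qed

text \<open>The extremal of the supremum bound: height 1 with slopes 2 and -2, so multiples of
  height below \<open>sqrt \<rho> / 2\<close> stay in the ball.\<close>

definition tent :: "real \<Rightarrow> real" where
  "tent t = max 0 (1 - \<bar>2 * t - 1\<bar>)"

lemma tent_finite_energy:
  shows "finite_energy (\<lambda>t. a * tent t)" "dirichlet (\<lambda>t. a * tent t) (\<lambda>t. a * tent t) \<le> (2 * \<bar>a\<bar>)\<^sup>2"
proof -
  have c: "continuous_on UNIV (\<lambda>t. a * tent t)" unfolding tent_def by (intro continuous_intros)
  have z: "a * tent t = 0" if "t \<notin> {0<..<1}" for t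
    using that unfolding tent_def by (auto simp: max_def)
  have l: "\<bar>a * tent t - a * tent s\<bar> \<le> 2 * \<bar>a\<bar> * (t - s)" if "s \<le> t" for s t
  proof -
    have "\<bar>tent t - tent s\<bar> \<le> 2 * (t - s)" using that unfolding tent_def by (auto simp: max_def)
    then have "\<bar>a\<bar> * \<bar>tent t - tent s\<bar> \<le> \<bar>a\<bar> * (2 * (t - s))" by (intro mult_left_mono) auto
    then show ?thesis by (simp add: abs_mult[symmetric] algebra_simps)
  qed
  show "finite_energy (\<lambda>t. a * tent t)" by (rule lipschitz_finite_energy(1)[OF c z l])
  show "dirichlet (\<lambda>t. a * tent t) (\<lambda>t. a * tent t) \<le> (2 * \<bar>a\<bar>)\<^sup>2"
    by (rule lipschitz_finite_energy(2)[OF c z l])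
qed

section \<open>Continuity of the potential and compactness of the sublevel sets\<close>

context kirchhoff
begin

lemma potential_integrand_continuous:
  assumes "continuous_on {0..1} u"
  shows "continuous_on {0..1} (\<lambda>t. C0_apply (fst p) t * u t + C0_apply (snd p) t * F (u t))"
  by (intro continuous_intros C0_apply_continuous continuous_on_compose2[OF F_continuous[of UNIV]] assms) simp

lemma potential_linear:
  assumes "continuous_on {0..1} u"
  shows "linear (potential u)"
proof (rule linearI)
  note int = integrable_continuous_interval[OF potential_integrand_continuous[OF assms]]
  show "potential u (p + q) = potential u p + potential u q" for p q
    unfolding potential_def Henstock_Kurzweil_Integration.integral_add[OF int int, symmetric]
    by (intro Henstock_Kurzweil_Integration.integral_cong) (simp add: plus_C0_unit.rep_eq algebra_simps)
  show "potential u (c *\<^sub>R p) = c *\<^sub>R potential u p" for c p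
    unfolding potential_def integral_cmul[symmetric]
    by (intro Henstock_Kurzweil_Integration.integral_cong) (simp add: scaleR_C0_unit.rep_eq algebra_simps)
qed

text \<open>With x and t independent on a compact rectangle, one constant serves all functions
  bounded by R, both as upper bound and as dominating function.\<close>

lemma potential_integrand_bounded:
  obtains C where "\<And>x t. \<bar>x\<bar> \<le> R \<Longrightarrow> t \<in> {0..1} \<Longrightarrow>
    norm (C0_apply (fst p) t * x + C0_apply (snd p) t * F x) \<le> C"
proof -
  have "continuous_on ({-R..R} \<times> {0..1}) (\<lambda>(x, t). C0_apply (fst p) t * x + C0_apply (snd p) t * F x)"
    unfolding case_prod_unfold
    by (intro continuous_intros continuous_on_compose2[OF C0_apply_continuous]
        continuous_on_compose2[OF F_continuous[of UNIV]]) auto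
  then have "bounded ((\<lambda>(x, t). C0_apply (fst p) t * x + C0_apply (snd p) t * F x) ` ({-R..R} \<times> {0..1}))"
    by (intro compact_imp_bounded compact_continuous_image compact_Times compact_Icc)
  then obtain C where C: "\<And>y. y \<in> (\<lambda>(x, t). C0_apply (fst p) t * x + C0_apply (snd p) t * F x) ` ({-R..R} \<times> {0..1})
      \<Longrightarrow> norm y \<le> C"
    unfolding bounded_iff by blast
  show ?thesis by (rule that, rule C) force
qed

lemma potential_bounded:
  obtains C where "\<And>u. continuous_on {0..1} u \<Longrightarrow> (\<And>t. \<bar>u t\<bar> \<le> R) \<Longrightarrow> potential u p \<le> C"
proof -
  obtain C where C: "\<And>x t. \<bar>x\<bar> \<le> R \<Longrightarrow> t \<in> {0..1} \<Longrightarrow>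
      norm (C0_apply (fst p) t * x + C0_apply (snd p) t * F x) \<le> C"
    using potential_integrand_bounded[of R p] by blast
  have "potential u p \<le> C" if u: "continuous_on {0..1} u" "\<And>t. \<bar>u t\<bar> \<le> R" for u
  proof -
    have "C0_apply (fst p) t * u t + C0_apply (snd p) t * F (u t) \<le> C" if "t \<in> {0..1}" for t
      using C[OF u(2) that] unfolding real_norm_def by (rule order_trans[OF abs_ge_self])
    then have "potential u p \<le> integral {0..1::real} (\<lambda>_. C)"
      unfolding potential_def
      by (intro integral_le integrable_continuous_interval potential_integrand_continuous u continuous_on_const)
    then show ?thesis by simp
  qed
  then show ?thesis by (rule that)
qed

lemma potential_tendsto:
  assumes u: "\<And>k. continuous_on {0..1} (u k)" "\<And>k t. \<bar>u k t\<bar> \<le> R"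
    and lim: "\<And>t. (\<lambda>k. u k t) \<longlonglongrightarrow> l t"
  shows "(\<lambda>k. potential (u k) p) \<longlonglongrightarrow> potential l p"
proof -
  obtain C where C: "\<And>x t. \<bar>x\<bar> \<le> R \<Longrightarrow> t \<in> {0..1} \<Longrightarrow>
      norm (C0_apply (fst p) t * x + C0_apply (snd p) t * F x) \<le> C"
    using potential_integrand_bounded[of R p] by blast
  have F: "isCont F x" for x using F_has_derivative DERIV_isCont by blast
  show ?thesis
    unfolding potential_def
  proof (rule dominated_convergence(2)[where h = "\<lambda>_. C"])
    show "(\<lambda>t. C0_apply (fst p) t * u k t + C0_apply (snd p) t * F (u k t)) integrable_on {0..1}" for k
      by (intro integrable_continuous_interval potential_integrand_continuous u)
    show "(\<lambda>k. C0_apply (fst p) t * u k t + C0_apply (snd p) t * F (u k t))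
        \<longlonglongrightarrow> C0_apply (fst p) t * l t + C0_apply (snd p) t * F (l t)" for t
      by (intro tendsto_intros lim isCont_tendsto_compose[OF F])
  qed (use C u in auto)
qed

text \<open>The potential is bounded on the ball, so coercivity keeps the energy on a sublevel set
  below some \<kappa> < \<rho>. Limits thus stay inside the open ball, and a loss of energy can only
  lower \<open>Om\<close>.\<close>

lemma sublevel_compact:
  "compact {u :: real \<Rightarrow>\<^sub>C real. (finite_energy u \<and> dirichlet u u < \<rho>) \<and>
     Om (dirichlet u u) / 2 - potential u p \<le> c}" (is "compact ?K")
proof -
  obtain C where C: "\<And>u. continuous_on {0..1} u \<Longrightarrow> (\<And>t. \<bar>u t\<bar> \<le> sqrt \<rho>) \<Longrightarrow> potential u p \<le> C"
    using potential_bounded[of "sqrt \<rho>" p] by blast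
  have abs: "\<bar>u t\<bar> \<le> sqrt \<rho>" if "finite_energy u" "dirichlet u u < \<rho>" for u t
    using abs_le_dirichlet[OF that(1), of t] that(2) real_sqrt_le_mono[of "dirichlet u u" \<rho>] by linarith
  \<comment> \<open>Beyond this threshold \<open>Om \<xi> / 2 - C \<ge> c + 1 / 2\<close>, too large
    for the sublevel set.\<close>
  have "\<forall>\<^sub>F \<xi> in at_left \<rho>. 2 * (c + C) + 1 \<le> Om \<xi>"
    using \<omega>_coercive unfolding filterlim_at_top Om_def[symmetric] by blast
  then obtain b where b: "b < \<rho>" "\<And>\<xi>. b < \<xi> \<Longrightarrow> \<xi> < \<rho> \<Longrightarrow> 2 * (c + C) + 1 \<le> Om \<xi>"
    unfolding eventually_at_left_field by blast
  define \<kappa> where "\<kappa> = max b 0"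
  have \<kappa>: "\<kappa> < \<rho>" using b \<rho>_pos by (simp add: \<kappa>_def)
  have E\<kappa>: "dirichlet u u \<le> \<kappa>" if "u \<in> ?K" for u
  proof (rule ccontr)
    assume "\<not> ?thesis"
    then have "2 * (c + C) + 1 \<le> Om (dirichlet u u)" using b that by (auto simp: \<kappa>_def)
    moreover have "potential u p \<le> C" using that by (intro C abs) auto
    ultimately show False using that by auto
  qed
  have "seq_compact ?K"
    unfolding seq_compact_def
  proof (intro allI impI)
    fix u :: "nat \<Rightarrow> real \<Rightarrow>\<^sub>C real" assume uK: "\<forall>n. u n \<in> ?K"
    then have u: "\<And>n. finite_energy (u n)" "\<And>n. dirichlet (u n) (u n) < \<rho>"
      "\<And>n. Om (dirichlet (u n) (u n)) / 2 - potential (u n) p \<le> c" "\<And>n. dirichlet (u n) (u n) \<le> \<kappa>"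
      using E\<kappa> by auto
    obtain r l e where r: "strict_mono r" "(u \<circ> r) \<longlonglongrightarrow> l" and l1: "finite_energy l"
      and e: "e \<le> \<kappa>" "(\<lambda>k. dirichlet (u (r k)) (u (r k))) \<longlonglongrightarrow> e" and l2: "dirichlet l l \<le> e"
      by (rule bounded_energy_subsequence[OF u(1,4)])
    note l = l1 l2
    have "uniform_limit UNIV (\<lambda>k. apply_bcontfun ((u \<circ> r) k)) (apply_bcontfun l) sequentially"
      using r(2) by (rule tendsto_bcontfun_uniform_limit)
    from tendsto_uniform_limitI[OF this] have ptw: "(\<lambda>k. u (r k) t) \<longlonglongrightarrow> l t" for t
      by (simp add: o_def)
    have e0: "0 \<le> e" "e < \<rho>" using dirichlet_nonneg[OF l(1)] l(2) e(1) \<kappa> by linarith+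
    have "(\<lambda>k. Om (dirichlet (u (r k)) (u (r k)))) \<longlonglongrightarrow> Om e"
      by (rule continuous_on_tendsto_compose[OF Om_continuous e(2)])
        (use e0 u dirichlet_nonneg in auto)
    moreover have "(\<lambda>k. potential (u (r k)) p) \<longlonglongrightarrow> potential l p"
      by (rule potential_tendsto[OF _ abs[OF u(1,2)] ptw]) simp
    ultimately have "(\<lambda>k. Om (dirichlet (u (r k)) (u (r k))) / 2 - potential (u (r k)) p)
        \<longlonglongrightarrow> Om e / 2 - potential l p"
      by (intro tendsto_intros) auto
    then have "Om e / 2 - potential l p \<le> c"
      by (rule LIMSEQ_le_const2) (use u(3) in auto)
    moreover have "Om (dirichlet l l) \<le> Om e"
      using dirichlet_nonneg[OF l(1)] l(2) e0 by (intro Om_mono)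
    ultimately have "l \<in> ?K" using l e0 by auto
    then show "\<exists>l\<in>?K. \<exists>r. strict_mono r \<and> (u \<circ> r) \<longlonglongrightarrow> l" using r by blast
  qed
  then show ?thesis by (simp add: compact_eq_seq_compact_metric)
qed

text \<open>Differentiating the midpoint identity in a gives f ((a + b) / 2) = f a; the pairs (a, 0)
  and (0, a) then give f a = f 0. Heights must stay strictly below r, so the end points are
  recovered by continuity of f.\<close>

lemma exists_not_midpoint_affine:
  assumes "\<not> f constant_on {- r..r}" "0 < r"
  shows "\<exists>a b. \<bar>a\<bar> < r \<and> \<bar>b\<bar> < r \<and> F ((a + b) / 2) \<noteq> (F a + F b) / 2"
proof (rule ccontr)
  assume "\<not> ?thesis"
  then have mid: "F ((a + b) / 2) = (F a + F b) / 2" if "\<bar>a\<bar> < r" "\<bar>b\<bar> < r" for a b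
    using that by blast
  have half: "f ((a + b) / 2) = f a" if "a \<in> {-r<..<r}" "b \<in> {-r<..<r}" for a b
  proof -
    have 1: "((\<lambda>x. F ((x + b) / 2)) has_real_derivative f ((a + b) / 2) * (1 / 2)) (at a)"
      by (rule DERIV_chain2[OF F_has_derivative]) (auto intro!: derivative_eq_intros)
    have 2: "((\<lambda>x. F ((x + b) / 2)) has_real_derivative f a / 2) (at a)"
    proof (rule has_field_derivative_transform_within_open[of "\<lambda>x. (F x + F b) / 2" _ _ "{-r<..<r}"])
      show "((\<lambda>x. (F x + F b) / 2) has_real_derivative f a / 2) (at a)"
        by (auto intro!: derivative_eq_intros F_has_derivative)
      show "(F x + F b) / 2 = F ((x + b) / 2)" if "x \<in> {-r<..<r}" for x
        using mid[of x b] that \<open>b \<in> _\<close> by auto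
    qed (use that in auto)
    show ?thesis using DERIV_unique[OF 1 2] by simp
  qed
  have eq: "f a = f 0" if "a \<in> {-r<..<r}" for a
    using half[of a 0] half[of 0 a] that assms(2) by (simp add: add.commute)
  have "closed {x. f x = f 0}"
    by (intro closed_Collect_eq f_cont continuous_on_const)
  then have "closure {-r<..<r} \<subseteq> {x. f x = f 0}" by (rule closure_minimal[rotated]) (use eq in blast)
  then have "\<forall>x\<in>{-r..r}. f x = f 0" using assms(2) by auto
  then show False using assms(1) unfolding constant_on_def by blast
qed

text \<open>\<open>u \<mapsto> (u, F \<circ> u)\<close> does not have convex range: the midpoint of its values at \<open>a tent\<close> and
  \<open>b tent\<close> is not attained. Measuring the linear part of the functional from this midpoint makes
  it unbounded over any dense set of pairs, yet keeps all minima below a fixed number.\<close>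

lemma two_solutions:
  assumes ab: "\<bar>a\<bar> < sqrt \<rho> / 2" "\<bar>b\<bar> < sqrt \<rho> / 2" "F ((a + b) / 2) \<noteq> (F a + F b) / 2"
    and S: "convex S" "dense_pair S"
  shows "\<exists>(\<alpha>, \<beta>)\<in>S. two_classical_solutions f \<rho> \<omega> \<alpha> \<beta>"
proof -
  define X where "X = {u :: real \<Rightarrow>\<^sub>C real. finite_energy u \<and> dirichlet u u < \<rho>}"
  have toX: "\<exists>w\<in>X. apply_bcontfun w = v" if "finite_energy v" "dirichlet v v < \<rho>" for v
    using that Bcontfun_inverse[OF finite_energy_bcontfun[OF that(1)]]
    by (intro bexI[of _ "Bcontfun v"]) (auto simp: X_def)
  have tent: "\<exists>w\<in>X. apply_bcontfun w = (\<lambda>t. a * tent t)" if "\<bar>a\<bar> < sqrt \<rho> / 2" for a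
  proof (rule toX[OF tent_finite_energy(1) order_le_less_trans[OF tent_finite_energy(2)]])
    have "(2 * \<bar>a\<bar>)\<^sup>2 < (sqrt \<rho>)\<^sup>2" using that by (intro power_strict_mono) auto
    then show "(2 * \<bar>a\<bar>)\<^sup>2 < \<rho>" using \<rho>_pos by simp
  qed
  obtain u1 where u1: "u1 \<in> X" "apply_bcontfun u1 = (\<lambda>t. a * tent t)" using tent[OF ab(1)] by blast
  obtain u2 where u2: "u2 \<in> X" "apply_bcontfun u2 = (\<lambda>t. b * tent t)" using tent[OF ab(2)] by blast
  define I where "I u = Om (dirichlet u u) / 2" for u :: "real \<Rightarrow>\<^sub>C real"
  \<comment> \<open>The added average does not depend on u, so for each y the minimisers are those
    of the original functional.\<close>
  define L where "L u y = (potential u1 y + potential u2 y) / 2 - potential u y" for u :: "real \<Rightarrow>\<^sub>C real" and y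
  define M where "M = (I u1 + I u2) / 2"
  have "\<exists>y\<in>S. \<exists>u\<in>X. \<exists>v\<in>X. u \<noteq> v \<and> (\<forall>z\<in>X. I u + L u y \<le> I z + L z y)
           \<and> (\<forall>z\<in>X. I v + L v y \<le> I z + L z y)"
  proof (rule two_global_minimizers)
    have P: "linear (potential u)" for u :: "real \<Rightarrow>\<^sub>C real" by (rule potential_linear) simp
    show "linear (L u)" for u
      by (rule linearI) (simp_all add: L_def linear_add[OF P] linear_scale[OF P] algebra_simps add_divide_distrib)
    show "convex S" by (rule S)
    show "S \<noteq> {}" using S(2) unfolding dense_pair_def by (metis empty_iff zero_less_one)
    show "compact {u \<in> X. I u + L u y \<le> c}" for y c
    proof -
      have "{u \<in> X. I u + L u y \<le> c} = {u :: real \<Rightarrow>\<^sub>C real. (finite_energy u \<and> dirichlet u u < \<rho>) \<and>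
         Om (dirichlet u u) / 2 - potential u y \<le> c - (potential u1 y + potential u2 y) / 2}"
        by (auto simp: X_def I_def L_def)
      then show ?thesis using sublevel_compact by simp
    qed
    show "\<exists>u\<in>X. I u + L u y \<le> M" for y
    proof -
      \<comment> \<open>The potentials cancel in the sum, so for every y one of the two tents lies
        at or below M.\<close>
      have "(I u1 + L u1 y) + (I u2 + L u2 y) = 2 * M" unfolding L_def M_def by (simp add: field_simps)
      then have "I u1 + L u1 y \<le> M \<or> I u2 + L u2 y \<le> M" by linarith
      then show ?thesis using u1 u2 by blast
    qed
    show "\<exists>y\<in>S. M < I u + L u y" for u
    proof -
      define p where "p t = (u1 t + u2 t) / 2 - u t" for t
      define q where "q t = (F (u1 t) + F (u2 t)) / 2 - F (u t)" for t
      have cF: "continuous_on {0..1} (\<lambda>t. F (apply_bcontfun u t))" for u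
        by (rule continuous_on_compose2[OF F_continuous[of UNIV]]) auto
      \<comment> \<open>At 1 / 2 the tents take the values a and b themselves, so the failure of
        midpoint affinity is visible at this one point for every u.\<close>
      have "p (1 / 2) \<noteq> 0 \<or> q (1 / 2) \<noteq> 0"
      proof (rule ccontr)
        assume "\<not> ?thesis"
        then have "u (1 / 2) = (a + b) / 2" "F (u (1 / 2)) = (F a + F b) / 2"
          by (simp_all add: p_def q_def u1 u2 tent_def)
        then show False using ab(3) by metis
      qed
      moreover have "continuous_on {0..1} p" unfolding p_def by (intro continuous_intros) auto
      moreover have "continuous_on {0..1} q" unfolding q_def by (intro continuous_intros cF) auto
      ultimately obtain y where y: "y \<in> S"
        "M - I u < integral {0..1} (\<lambda>t. C0_apply (fst y) t * p t + C0_apply (snd y) t * q t)"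
        using dense_pair_functional_unbounded[of p q "1 / 2" S "M - I u"] S(2) by auto
      define g where "g u t = C0_apply (fst y) t * u t + C0_apply (snd y) t * F (u t)" for u t
      have gi: "g (apply_bcontfun u) integrable_on {0..1}" for u
        unfolding g_def by (intro integrable_continuous_interval potential_integrand_continuous) auto
      have "L u y = (integral {0..1} (g u1) + integral {0..1} (g u2)) / 2 - integral {0..1} (g u)"
        unfolding L_def potential_def g_def ..
      also have "\<dots> = integral {0..1} (\<lambda>t. (g u1 t + g u2 t) / 2 - g u t)"
        by (simp add: Henstock_Kurzweil_Integration.integral_diff Henstock_Kurzweil_Integration.integral_add
            integrable_add integrable_on_divide gi)
      also have "(\<lambda>t. (g u1 t + g u2 t) / 2 - g u t) = (\<lambda>t. C0_apply (fst y) t * p t + C0_apply (snd y) t * q t)"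
        unfolding g_def p_def q_def by (auto simp: field_simps)
      finally show ?thesis using y by force
    qed
  qed
  then obtain y u v where y: "y \<in> S" and u: "u \<in> X" "\<forall>z\<in>X. I u + L u y \<le> I z + L z y"
    and v: "v \<in> X" "\<forall>z\<in>X. I v + L v y \<le> I z + L z y" and ne: "u \<noteq> v" by blast
  obtain \<alpha> \<beta> where y': "y = (\<alpha>, \<beta>)" by (cases y)
  have sol: "classical_solution f \<rho> \<omega> \<alpha> \<beta> u" if "u \<in> X" "\<forall>z\<in>X. I u + L u y \<le> I z + L z y" for u
  proof (rule minimizer_is_solution)
    show "finite_energy u" "dirichlet u u < \<rho>" using that(1) by (auto simp: X_def)
    fix w assume "finite_energy w" "dirichlet w w < \<rho>"
    then obtain z where z: "z \<in> X" "apply_bcontfun z = w" using toX by blast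
    show "Om (dirichlet u u) / 2 - potential u (\<alpha>, \<beta>) \<le> Om (dirichlet w w) / 2 - potential w (\<alpha>, \<beta>)"
      using that(2) z unfolding I_def L_def y' by auto
  qed
  have "\<exists>t\<in>{0..1}. u t \<noteq> v t"
  proof (rule ccontr)
    assume eq: "\<not> ?thesis"
    have "u t = v t" for t
    proof (cases "t \<in> {0..1}")
      case False
      then have "t \<notin> {0<..<1}" by auto
      then show ?thesis using u(1) v(1) by (simp add: X_def finite_energyD(2))
    qed (use eq in auto)
    then show False using ne by (auto intro: bcontfun_eqI)
  qed
  then have "two_classical_solutions f \<rho> \<omega> \<alpha> \<beta>"
    unfolding two_classical_solutions_def using sol[OF u] sol[OF v] by blast
  then show ?thesis using y y' by blast
qed

end

theorem theorem2p10:
  fixes f \<omega> :: "real \<Rightarrow> real" and \<rho> :: real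
  assumes "continuous_on UNIV f"
    and "\<rho> > 0"
    and "continuous_on {0..<\<rho>} \<omega>"
    and "\<omega> \<in> {0..<\<rho>} \<rightarrow> {0..}"
    and "strict_mono_on {0..<\<rho>} \<omega>"
    and "filterlim (\<lambda>\<xi>. integral {0..\<xi>} \<omega>) at_top (at_left \<rho>)"
  shows "\<not> f constant_on {- (sqrt \<rho> / 2)..sqrt \<rho> / 2} \<longleftrightarrow>
    (\<forall>S :: (C0_unit \<times> C0_unit) set. convex S \<and> dense_pair S \<longrightarrow>
       (\<exists>(\<alpha>, \<beta>)\<in>S. two_classical_solutions f \<rho> \<omega> \<alpha> \<beta>))"
proof -
  interpret kirchhoff f \<omega> \<rho>
    by standard (use assms in \<open>auto simp: Pi_iff strict_mono_on_def\<close>)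
  show ?thesis
  proof (intro iffI allI impI)
    fix S :: "(C0_unit \<times> C0_unit) set"
    assume "\<not> f constant_on {- (sqrt \<rho> / 2)..sqrt \<rho> / 2}" and S: "convex S \<and> dense_pair S"
    moreover have "0 < sqrt \<rho> / 2" using assms(2) by simp
    ultimately obtain a b where "\<bar>a\<bar> < sqrt \<rho> / 2" "\<bar>b\<bar> < sqrt \<rho> / 2" "F ((a + b) / 2) \<noteq> (F a + F b) / 2"
      using exists_not_midpoint_affine by blast
    then show "\<exists>(\<alpha>, \<beta>)\<in>S. two_classical_solutions f \<rho> \<omega> \<alpha> \<beta>"
      using two_solutions S by blast
  next
    assume "\<forall>S :: (C0_unit \<times> C0_unit) set. convex S \<and> dense_pair S \<longrightarrow>
       (\<exists>(\<alpha>, \<beta>)\<in>S. two_classical_solutions f \<rho> \<omega> \<alpha> \<beta>)"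
    \<comment> \<open>The whole space is test set enough: for constant f no pair whatsoever has two
      solutions.\<close>
    moreover have "dense_pair UNIV"
      unfolding dense_pair_def
    proof (intro allI impI)
      fix p :: "C0_unit \<times> C0_unit" and e :: real assume "0 < e"
      then show "\<exists>q\<in>UNIV. pair_norm (q - p) < e"
        by (intro bexI[of _ p]) (auto simp: pair_norm_def zero_C0_unit.rep_eq)
    qed
    ultimately obtain \<alpha> \<beta> where "two_classical_solutions f \<rho> \<omega> \<alpha> \<beta>" using convex_UNIV by blast
    then obtain u v t where sol: "classical_solution f \<rho> \<omega> \<alpha> \<beta> u" "classical_solution f \<rho> \<omega> \<alpha> \<beta> v"
      and t: "t \<in> {0..1}" "u t \<noteq> v t"
      unfolding two_classical_solutions_def by blast
    show "\<not> f constant_on {- (sqrt \<rho> / 2)..sqrt \<rho> / 2}"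
    proof
      assume "f constant_on {- (sqrt \<rho> / 2)..sqrt \<rho> / 2}"
      then obtain c where "\<And>x. x \<in> {- (sqrt \<rho> / 2)..sqrt \<rho> / 2} \<Longrightarrow> f x = c"
        unfolding constant_on_def by blast
      then show False using constant_imp_unique[OF _ sol t(1)] t(2) by blast
    qed
  qed
qed

end
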